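(* Let $\Gamma$ be a bridgeless metrized graph with $v=\#V(\Gamma)\ge3$ vertices. Then $$\tau(\Gamma)=\frac{\ell(\Gamma)}{12}-\frac{1}{6\,(v-2)!}\sum_{e_{i_1}\in E(\Gamma)}\frac{R_{i_1}}{L_{i_1}+R_{i_1}}\cdots\sum_{e_{i_{v-2}}\in E(\overline{\Gamma}_{i_1,\dots,i_{v-3}})}\frac{R_{i_{v-2}}}{L_{i_{v-2}}+R_{i_{v-2}}}\,(n'-2)\,r'(p,q),$$ where for each term in which $\overline{\Gamma}_{i_1,\dots,i_{v-2}}$ is an admissible contraction, $n'$ and $r'(p,q)$ are as defined below (terms that are not admissible contractions have a zero coefficient).
   Context: A metrized graph is a finite connected graph (multiple edges and self-loops allowed) whose edges $e_j$ are identified with closed segments of lengths $L_j>0$; its vertex set $V(\Gamma)$ is finite, nonempty, and contains all points of valence $\neq2$; $\ell(\Gamma)=\sum L_j$. $G-e_j$ is $G$ with the interior of $e_j$ removed; $\Gamma$ is bridgeless if every $\Gamma-e_j$ is connected. $\overline{\Gamma}_{i_1}$ is obtained by contracting edge $e_{i_1}$ of $\Gamma$ to a point, and inductively $\overline{\Gamma}_{i_1,\dots,i_k}$ by contracting edge $e_{i_k}$ of $\overline{\Gamma}_{i_1,\dots,i_{k-1}}$. In the sum over $e_{i_t}\in E(\overline{\Gamma}_{i_1,\dots,i_{t-1}})$, $R_{i_t}$ is the effective resistance between the endpoints of $e_{i_t}$ in $\overline{\Gamma}_{i_1,\dots,i_{t-1}}-e_{i_t}$ (edges are resistors with resistance equal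 to length); for a self-loop $R_{i_t}=0$. $\overline{\Gamma}_{i_1,\dots,i_{v-2}}$ is an admissible contraction if it has exactly two vertices $p,q$ (i.e. each contracted edge had distinct endpoints); it then consists of $n'=n(i_1,\dots,i_{v-2})$ parallel edges between $p$ and $q$ plus possibly self-loops, and $r'(p,q)=\big(\sum_{t=1}^{n'}1/L_{j_t}\big)^{-1}$ is the effective resistance between $p$ and $q$, where $L_{j_1},\dots,L_{j_{n'}}$ are the lengths of those parallel edges. With $r(x,y)$ effective resistance, $\tau(\Gamma)=\frac14\int_\Gamma(\frac{\partial}{\partial x}r(x,y))^2dx$ (independent of $y$). *)

theory Defs
  imports "HOL-Analysis.Analysis" "Graph_Theory.Digraph_Component"
begin

text \<open>
  A metrized graph together with a vertex set is a finite multi-digraph \<open>G\<close> with positive arc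
  lengths \<open>L\<close>: every edge is one arc, whose orientation is an arbitrary choice that only serves to
  identify the edge \<open>e\<close> with the segment \<open>[0, L e]\<close>.  Loops and parallel arcs are allowed.
  \<open>Digraph_Component.connected\<close> disregards orientations and entails that there is a vertex; points
  of valence different from 2 are vertices by construction.
\<close>

locale metrized_graph = fin_digraph G for G :: "('a, 'b) pre_digraph" (structure) +
  fixes L :: "'b \<Rightarrow> real"
  assumes graph_connected: "Digraph_Component.connected G"
    and length_pos: "e \<in> arcs G \<Longrightarrow> 0 < L e"

definition total_length :: "('a, 'b) pre_digraph \<Rightarrow> ('b \<Rightarrow> real) \<Rightarrow> real" where
  "total_length G L = (\<Sum>e\<in>arcs G. L e)"

definition bridgeless :: "('a, 'b) pre_digraph \<Rightarrow> bool" where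
  "bridgeless G \<longleftrightarrow> (\<forall>e\<in>arcs G. Digraph_Component.connected (pre_digraph.del_arc G e))"


subsection \<open>Effective resistance\<close>

text \<open>
  Every edge is a resistor with resistance equal to its length.  \<open>unit_potential G L p q f\<close> says
  that \<open>f\<close> is an electric potential when unit current enters at \<open>p\<close> and leaves at \<open>q\<close> (Kirchhoff's
  current law with Ohm's law: the net current flowing out of \<open>x\<close> into the edges is the external
  current at \<open>x\<close>).  The potential difference is unique whenever \<open>p\<close> and \<open>q\<close> are connected.
\<close>

definition unit_potential ::
    "('a, 'b) pre_digraph \<Rightarrow> ('b \<Rightarrow> real) \<Rightarrow> 'a \<Rightarrow> 'a \<Rightarrow> ('a \<Rightarrow> real) \<Rightarrow> bool" where
  "unit_potential G L p q f \<longleftrightarrow> (\<forall>x\<in>verts G.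
      (\<Sum>e\<in>out_arcs G x. (f x - f (head G e)) / L e)
      + (\<Sum>e\<in>in_arcs G x. (f x - f (tail G e)) / L e)
    = (if x = p then 1 else 0) - (if x = q then 1 else 0))"

definition eff_res :: "('a, 'b) pre_digraph \<Rightarrow> ('b \<Rightarrow> real) \<Rightarrow> 'a \<Rightarrow> 'a \<Rightarrow> real" where
  "eff_res G L p q = (THE r. \<exists>f. unit_potential G L p q f \<and> r = f p - f q)"


subsection \<open>Points of a metrized graph and the tau constant\<close>

text \<open>\<open>Interior e t\<close> is the point of the edge \<open>e\<close> at distance \<open>t\<close> from its tail, \<open>0 < t < L e\<close>.\<close>

datatype ('a, 'b) point = Vertex 'a | Interior 'b real

definition points :: "('a, 'b) pre_digraph \<Rightarrow> ('b \<Rightarrow> real) \<Rightarrow> ('a, 'b) point set" where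
  "points G L = Vertex ` verts G \<union> {Interior e t |e t. e \<in> arcs G \<and> 0 < t \<and> t < L e}"

definition edge_point ::
    "('a, 'b) pre_digraph \<Rightarrow> ('b \<Rightarrow> real) \<Rightarrow> 'b \<Rightarrow> real \<Rightarrow> ('a, 'b) point" where
  "edge_point G L e t =
    (if t = 0 then Vertex (tail G e) else if t = L e then Vertex (head G e) else Interior e t)"

definition cuts :: "('b \<Rightarrow> real) \<Rightarrow> ('a, 'b) point set \<Rightarrow> 'b \<Rightarrow> real set" where
  "cuts L S e = {0, L e} \<union> {t. 0 < t \<and> t < L e \<and> Interior e t \<in> S}"

text \<open>
  The same metrized graph with the points of \<open>S\<close> added to the vertex set.  The edge
  \<open>(e, a, b)\<close> is the part of \<open>e\<close> between the consecutive cut positions \<open>a\<close> and \<open>b\<close>.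
\<close>

definition subdivide ::
    "('a, 'b) pre_digraph \<Rightarrow> ('b \<Rightarrow> real) \<Rightarrow> ('a, 'b) point set
      \<Rightarrow> (('a, 'b) point, 'b \<times> real \<times> real) pre_digraph" where
  "subdivide G L S =
    \<lparr> verts = Vertex ` verts G \<union> (S \<inter> points G L),
      arcs = {(e, a, b) |e a b. e \<in> arcs G \<and> a \<in> cuts L S e \<and> b \<in> cuts L S e \<and> a < b
                               \<and> {a<..<b} \<inter> cuts L S e = {}},
      tail = (\<lambda>(e, a, b). edge_point G L e a),
      head = (\<lambda>(e, a, b). edge_point G L e b) \<rparr>"

text \<open>The resistance function \<open>r(x,y)\<close> on arbitrary points of the metrized graph.\<close>

definition resistance ::
    "('a, 'b) pre_digraph \<Rightarrow> ('b \<Rightarrow> real) \<Rightarrow> ('a, 'b) point \<Rightarrow> ('a, 'b) point \<Rightarrow> real" where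
  "resistance G L x y = eff_res (subdivide G L {x, y}) (\<lambda>(e, a, b). b - a) x y"

text \<open>
  The integral over the metrized graph is the sum of the integrals over its edges; \<open>r(x,y)\<close> fails
  to be differentiable in \<open>x\<close> along an edge at finitely many points at most.
\<close>

definition tau_at :: "('a, 'b) pre_digraph \<Rightarrow> ('b \<Rightarrow> real) \<Rightarrow> ('a, 'b) point \<Rightarrow> real" where
  "tau_at G L y = 1 / 4 * (\<Sum>e\<in>arcs G.
     integral {0..L e} (\<lambda>t. (deriv (\<lambda>s. resistance G L (edge_point G L e s) y) t)\<^sup>2))"

text \<open>\<open>tau\<close> is the value common to all choices of the base point \<open>y\<close>.\<close>

definition tau :: "('a, 'b) pre_digraph \<Rightarrow> ('b \<Rightarrow> real) \<Rightarrow> real" where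
  "tau G L = (THE c. \<forall>y\<in>points G L. tau_at G L y = c)"


subsection \<open>Contractions\<close>

text \<open>Contracting \<open>e\<close> identifies its endpoints (the tail is kept as representative) and drops \<open>e\<close>.\<close>

definition contract_arc :: "('a, 'b) pre_digraph \<Rightarrow> 'b \<Rightarrow> ('a, 'b) pre_digraph" where
  "contract_arc G e =
    (let m = (\<lambda>x. if x = head G e then tail G e else x) in
     \<lparr> verts = m ` verts G, arcs = arcs G - {e}, tail = m \<circ> tail G, head = m \<circ> head G \<rparr>)"

text \<open>
  \<open>R\<^sub>e\<close>: the effective resistance between the endpoints of \<open>e\<close> in \<open>G - e\<close>.  For a loop both endpoints
  agree, so the value is 0.
\<close>

definition arc_res :: "('a, 'b) pre_digraph \<Rightarrow> ('b \<Rightarrow> real) \<Rightarrow> 'b \<Rightarrow> real" where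
  "arc_res G L e = eff_res (pre_digraph.del_arc G e) L (tail G e) (head G e)"

definition admissible :: "('a, 'b) pre_digraph \<Rightarrow> bool" where
  "admissible G \<longleftrightarrow> card (verts G) = 2"

text \<open>In a graph with exactly two vertices \<open>p\<close>, \<open>q\<close> these are the edges between \<open>p\<close> and \<open>q\<close>.\<close>

definition nonloops :: "('a, 'b) pre_digraph \<Rightarrow> 'b set" where
  "nonloops G = {e \<in> arcs G. tail G e \<noteq> head G e}"

definition parallel_res :: "('a, 'b) pre_digraph \<Rightarrow> ('b \<Rightarrow> real) \<Rightarrow> real" where
  "parallel_res G L = inverse (\<Sum>e\<in>nonloops G. 1 / L e)"

text \<open>
  The \<open>k\<close>-fold nested sum over successive contractions of one edge at a time.  The innermost factor
  of a contraction that is not admissible is set to 0; its coefficient vanishes anyway, since some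
  contracted edge was then a loop.
\<close>

fun contraction_sum :: "nat \<Rightarrow> ('a, 'b) pre_digraph \<Rightarrow> ('b \<Rightarrow> real) \<Rightarrow> real" where
  "contraction_sum 0 G L =
    (if admissible G then (real (card (nonloops G)) - 2) * parallel_res G L else 0)"
| "contraction_sum (Suc k) G L =
    (\<Sum>e\<in>arcs G. arc_res G L e / (L e + arc_res G L e) * contraction_sum k (contract_arc G e) L)"

end

theory Submission
  imports Defs
begin

text \<open>
  Let \<open>g\<close> be the Green function of the weighted graph Laplacian, grounded at a vertex \<open>z\<close>.  For an edge
  with ends \<open>a\<close>, \<open>b\<close> put \<open>r\<^sub>e = g a a + g b b - 2 g a b\<close> (the resistance between the ends) and
  \<open>M\<^sub>e = g a a * g b b - (g a b)\<^sup>2\<close>.  The factor \<open>R\<^sub>e / (L\<^sub>e + R\<^sub>e)\<close> is \<open>r\<^sub>e / L\<^sub>e\<close>, and contracting \<open>e\<close>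
  is a rank one update of \<open>g\<close>.  With Foster's theorem \<open>\<Sum>r\<^sub>e / L\<^sub>e = v - 1\<close> it follows that
  \<open>S = \<Sum>r\<^sub>e - 2 (\<Sum>g x x - \<Sum>M\<^sub>e / L\<^sub>e)\<close> satisfies \<open>\<Sum>r\<^sub>e / L\<^sub>e * S (G / e) = (v - 2) * S G\<close>, so the nested
  sum is \<open>(v - 2)! * S\<close>.  On the other side, \<open>r(x, y)\<close> is piecewise quadratic on each edge, and
  integrating its squared derivative gives \<open>\<ell> / 12 - S / 6\<close> by Kirchhoff's law for \<open>g\<close>.
\<close>



section \<open>The Dirichlet form of a weighted digraph\<close>

definition grad :: "('a, 'b) pre_digraph \<Rightarrow> ('a \<Rightarrow> real) \<Rightarrow> 'b \<Rightarrow> real" where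
  "grad G f e = f (head G e) - f (tail G e)"

definition dirichlet ::
    "('a, 'b) pre_digraph \<Rightarrow> ('b \<Rightarrow> real) \<Rightarrow> ('a \<Rightarrow> real) \<Rightarrow> ('a \<Rightarrow> real) \<Rightarrow> real" where
  "dirichlet G L f \<phi> = (\<Sum>e\<in>arcs G. grad G f e * grad G \<phi> e / L e)"

lemma dirichlet_commute: "dirichlet G L f \<phi> = dirichlet G L \<phi> f"
  by (simp add: dirichlet_def mult.commute)

lemma grad_add: "grad G (\<lambda>x. f x + h x) e = grad G f e + grad G h e"
  by (simp add: grad_def)

lemma grad_diff: "grad G (\<lambda>x. f x - h x) e = grad G f e - grad G h e"
  by (simp add: grad_def)

lemma grad_cmult: "grad G (\<lambda>x. c * f x) e = c * grad G f e"
  by (simp add: grad_def algebra_simps)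

lemma dirichlet_add_left: "dirichlet G L (\<lambda>x. f x + h x) \<phi> = dirichlet G L f \<phi> + dirichlet G L h \<phi>"
  by (simp add: dirichlet_def grad_add algebra_simps add_divide_distrib sum.distrib)

lemma dirichlet_diff_left: "dirichlet G L (\<lambda>x. f x - h x) \<phi> = dirichlet G L f \<phi> - dirichlet G L h \<phi>"
  by (simp add: dirichlet_def grad_diff algebra_simps diff_divide_distrib sum_subtractf)

lemma dirichlet_cmult_left: "dirichlet G L (\<lambda>x. c * f x) \<phi> = c * dirichlet G L f \<phi>"
  by (simp add: dirichlet_def grad_cmult sum_distrib_left mult.assoc)

lemma dirichlet_add_right: "dirichlet G L \<phi> (\<lambda>x. f x + h x) = dirichlet G L \<phi> f + dirichlet G L \<phi> h"
  by (metis dirichlet_commute dirichlet_add_left)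

lemma dirichlet_diff_right: "dirichlet G L \<phi> (\<lambda>x. f x - h x) = dirichlet G L \<phi> f - dirichlet G L \<phi> h"
  by (metis dirichlet_commute dirichlet_diff_left)

lemma dirichlet_cmult_right: "dirichlet G L \<phi> (\<lambda>x. c * f x) = c * dirichlet G L \<phi> f"
  by (metis dirichlet_commute dirichlet_cmult_left)

lemmas dirichlet_linear =
  dirichlet_add_left dirichlet_diff_left dirichlet_cmult_left
  dirichlet_add_right dirichlet_diff_right dirichlet_cmult_right

text \<open>Summation by parts: grouping the arcs once by tail and once by head, each arc is met
  from either end, and the two contributions combine to a product of differences.\<close>

lemma (in fin_digraph) sum_outflow:
  "(\<Sum>x\<in>verts G. \<phi> x * ((\<Sum>e\<in>out_arcs G x. (f x - f (head G e)) / L e)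
      + (\<Sum>e\<in>in_arcs G x. (f x - f (tail G e)) / L e))) = dirichlet G L f \<phi>"
proof -
  have out: "(\<Sum>x\<in>verts G. \<phi> x * (\<Sum>e\<in>out_arcs G x. (f x - f (head G e)) / L e))
      = (\<Sum>e\<in>arcs G. \<phi> (tail G e) * (f (tail G e) - f (head G e)) / L e)"
  proof -
    have "(\<Sum>x\<in>verts G. \<phi> x * (\<Sum>e\<in>out_arcs G x. (f x - f (head G e)) / L e))
       = (\<Sum>x\<in>verts G. \<Sum>e\<in>{e \<in> arcs G. tail G e = x}. \<phi> (tail G e) * (f (tail G e) - f (head G e)) / L e)"
      by (intro sum.cong) (auto simp: sum_distrib_left out_arcs_def)
    also have "\<dots> = (\<Sum>e\<in>arcs G. \<phi> (tail G e) * (f (tail G e) - f (head G e)) / L e)"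
      by (rule sum.group) auto
    finally show ?thesis .
  qed
  have inn: "(\<Sum>x\<in>verts G. \<phi> x * (\<Sum>e\<in>in_arcs G x. (f x - f (tail G e)) / L e))
      = (\<Sum>e\<in>arcs G. \<phi> (head G e) * (f (head G e) - f (tail G e)) / L e)"
  proof -
    have "(\<Sum>x\<in>verts G. \<phi> x * (\<Sum>e\<in>in_arcs G x. (f x - f (tail G e)) / L e))
       = (\<Sum>x\<in>verts G. \<Sum>e\<in>{e \<in> arcs G. head G e = x}. \<phi> (head G e) * (f (head G e) - f (tail G e)) / L e)"
      by (intro sum.cong) (auto simp: sum_distrib_left in_arcs_def)
    also have "\<dots> = (\<Sum>e\<in>arcs G. \<phi> (head G e) * (f (head G e) - f (tail G e)) / L e)"
      by (rule sum.group) auto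
    finally show ?thesis .
  qed
  show ?thesis
    unfolding distrib_left sum.distrib out inn
    unfolding dirichlet_def grad_def sum.distrib[symmetric]
    by (intro sum.cong) (auto simp: field_simps add_divide_distrib[symmetric] diff_divide_distrib[symmetric])
qed

text \<open>Weak form of Kirchhoff's law; indicators of vertices as test functions recover the
  pointwise law. In this form deleting or contracting an arc affects a single summand.\<close>

lemma (in fin_digraph) unit_potential_iff_dirichlet:
  assumes "p \<in> verts G" "q \<in> verts G"
  shows "unit_potential G L p q f \<longleftrightarrow> (\<forall>\<phi>. dirichlet G L f \<phi> = \<phi> p - \<phi> q)"
proof -
  define N where "N x = (\<Sum>e\<in>out_arcs G x. (f x - f (head G e)) / L e)
      + (\<Sum>e\<in>in_arcs G x. (f x - f (tail G e)) / L e)" for x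
  have N: "dirichlet G L f \<phi> = (\<Sum>x\<in>verts G. \<phi> x * N x)" for \<phi>
    unfolding N_def by (rule sum_outflow[symmetric])
  have "dirichlet G L f \<phi> = \<phi> p - \<phi> q" if "unit_potential G L p q f" for \<phi>
  proof -
    have "\<phi> x * N x = (if x = p then \<phi> x else 0) - (if x = q then \<phi> x else 0)" if "x \<in> verts G" for x
      using that \<open>unit_potential G L p q f\<close> by (auto simp: unit_potential_def N_def)
    then show ?thesis
      using assms by (simp add: N sum_subtractf)
  qed
  moreover have "N x = (if x = p then 1 else 0) - (if x = q then 1 else 0)"
    if x: "x \<in> verts G" and D: "\<forall>\<phi>. dirichlet G L f \<phi> = \<phi> p - \<phi> q" for x
  proof -
    have "N x = (\<Sum>y\<in>verts G. (if y = x then 1 else 0) * N y)"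
      using x by (subst sum.remove[of _ x]) (auto intro!: sum.neutral)
    also have "\<dots> = dirichlet G L f (\<lambda>y. if y = x then 1 else 0)"
      by (simp add: N)
    finally show ?thesis
      using spec[OF D, of "\<lambda>y. if y = x then 1 else 0"] by (auto split: if_splits)
  qed
  ultimately show ?thesis
    unfolding unit_potential_def N_def[symmetric] by blast
qed

text \<open>Two unit potentials have the same drop because the Dirichlet form is symmetric; no
  connectedness is involved.\<close>

lemma (in fin_digraph) eff_res_eq:
  assumes "p \<in> verts G" "q \<in> verts G" "\<And>\<phi>. dirichlet G L f \<phi> = \<phi> p - \<phi> q"
  shows "eff_res G L p q = f p - f q"
  unfolding eff_res_def
proof (rule the_equality)
  show "\<exists>h. unit_potential G L p q h \<and> f p - f q = h p - h q"
    using assms by (auto simp: unit_potential_iff_dirichlet)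
next
  fix r assume "\<exists>h. unit_potential G L p q h \<and> r = h p - h q"
  then obtain h where h: "\<And>\<phi>. dirichlet G L h \<phi> = \<phi> p - \<phi> q" and r: "r = h p - h q"
    using assms by (auto simp: unit_potential_iff_dirichlet)
  show "r = f p - f q"
    using h[of f] assms(3)[of h] r by (simp add: dirichlet_commute)
qed

section \<open>Kernel of the Dirichlet form and existence of potentials\<close>

lemma dirichlet_nonneg:
  assumes "\<And>e. e \<in> arcs G \<Longrightarrow> 0 < L e"
  shows "0 \<le> dirichlet G L f f"
  unfolding dirichlet_def using assms by (intro sum_nonneg) (simp add: less_imp_le)

lemma (in fin_digraph) dirichlet_eq_0D:
  assumes "\<And>e. e \<in> arcs G \<Longrightarrow> 0 < L e" "dirichlet G L f f \<le> 0" "e \<in> arcs G"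
  shows "grad G f e = 0"
proof -
  have "dirichlet G L f f = 0"
    using assms(2) dirichlet_nonneg[of G L f] assms(1) by simp
  then have "grad G f e * grad G f e / L e = 0"
    using assms by (simp add: dirichlet_def sum_nonneg_eq_0_iff less_imp_le)
  then show ?thesis
    using assms(1)[OF assms(3)] by simp
qed

lemma connected_grad_eq_0:
  assumes "Digraph_Component.connected G" "\<And>e. e \<in> arcs G \<Longrightarrow> grad G f e = 0"
    and "x \<in> verts G" "y \<in> verts G"
  shows "f x = f y"
proof -
  have "(x, y) \<in> rtrancl_on (verts G) ((arcs_ends G)\<^sup>s)"
    using assms by (simp add: connected_conv)
  then show ?thesis
  proof (induction rule: rtrancl_on_induct)
    case (step y u)
    from step(2) obtain e where "e \<in> arcs G" "y = tail G e \<and> u = head G e \<or> u = tail G e \<and> y = head G e"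
      by (auto simp: arcs_ends_conv symcl_def)
    with assms(2)[of e] step show ?case by (auto simp: grad_def)
  qed simp
qed

text \<open>
  Fredholm alternative for the quadratic form of a finite family of linear functionals \<open>h e\<close>
  (functionals on functions \<open>'a \<Rightarrow> real\<close>, with positive weights): a linear functional \<open>l\<close> is either
  represented by the form or does not vanish on the common kernel.
\<close>

lemma quadratic_form_alternative:
  fixes h :: "'b \<Rightarrow> ('a \<Rightarrow> real) \<Rightarrow> real" and l :: "('a \<Rightarrow> real) \<Rightarrow> real"
  assumes "finite A" "\<And>e. e \<in> A \<Longrightarrow> 0 < c e"
    and h: "\<And>e f u k. h e (\<lambda>x. f x + k * u x) = h e f + k * h e u"
    and "\<And>f u k. l (\<lambda>x. f x + k * u x) = l f + k * l u"
  shows "(\<exists>f. \<forall>\<phi>. (\<Sum>e\<in>A. c e * h e f * h e \<phi>) = l \<phi>) \<or> (\<exists>f. (\<forall>e\<in>A. h e f = 0) \<and> l f \<noteq> 0)"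
  using assms(1,2,4)
proof (induction A arbitrary: l rule: finite_induct)
  case empty
  then show ?case by auto
next
  case (insert d A)
  let ?Q = "\<lambda>f \<phi>. \<Sum>e\<in>A. c e * h e f * h e \<phi>"
  have Q_add: "?Q (\<lambda>x. f x + k * u x) \<phi> = ?Q f \<phi> + k * ?Q u \<phi>" for f u k \<phi>
    by (simp add: h algebra_simps sum.distrib sum_distrib_left)
  have Q_sym: "?Q f \<phi> = ?Q \<phi> f" for f \<phi>
    by (simp add: mult_ac)
  have ins: "(\<Sum>e\<in>insert d A. c e * h e f * h e \<phi>) = c d * h d f * h d \<phi> + ?Q f \<phi>" for f \<phi>
    using insert by simp
  have c: "0 < c d" "\<And>e. e \<in> A \<Longrightarrow> 0 < c e"
    using insert.prems by auto
  \<comment> \<open>The induction hypothesis is applied to the new functional \<open>h d\<close>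
    itself: either the old form already represents it, or some \<open>u\<close> in the old kernel
    detects it.\<close>
  consider (range) f0 where "\<And>\<phi>. ?Q f0 \<phi> = h d \<phi>"
    | (kernel) u where "\<And>e. e \<in> A \<Longrightarrow> h e u = 0" "h d u \<noteq> 0"
    using insert.IH[of "h d", OF c(2) h] by blast
  then show ?case
  proof cases
    case range
    have "0 \<le> h d f0"
      unfolding range[symmetric] using c by (intro sum_nonneg) (simp add: mult.assoc less_imp_le)
    then have pos: "1 + c d * h d f0 > 0"
      using c by (simp add: add_pos_nonneg)
    consider f where "\<And>\<phi>. ?Q f \<phi> = l \<phi>" | f where "\<And>e. e \<in> A \<Longrightarrow> h e f = 0" "l f \<noteq> 0"
      using insert.IH[of l, OF c(2) insert.prems(2)] by blast
    then show ?thesis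
    proof cases
      case 1
      \<comment> \<open>Sherman-Morrison: the enlarged form maps \<open>f0\<close> to
        \<open>1 + c d * h d f0\<close> times \<open>h d\<close>, so this multiple of
        \<open>f0\<close> cancels the surplus \<open>c d * h d f * h d \<phi>\<close>.\<close>
      define k where "k = - (c d * h d f / (1 + c d * h d f0))"
      have k: "c d * h d f + k * (1 + c d * h d f0) = 0"
        using pos by (simp add: k_def)
      have "c d * h d (\<lambda>x. f x + k * f0 x) * h d \<phi> + ?Q (\<lambda>x. f x + k * f0 x) \<phi> = l \<phi>" for \<phi>
      proof -
        have "c d * h d (\<lambda>x. f x + k * f0 x) * h d \<phi> + ?Q (\<lambda>x. f x + k * f0 x) \<phi>
            = l \<phi> + (c d * h d f + k * (1 + c d * h d f0)) * h d \<phi>"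
          unfolding Q_add 1 range unfolding h by (simp add: algebra_simps)
        then show ?thesis using k by simp
      qed
      then show ?thesis unfolding ins by blast
    next
      case 2
      have "h d f = ?Q f0 f" by (simp add: range)
      also have "\<dots> = 0" using 2 by simp
      finally show ?thesis using 2 by auto
    qed
  next
    case kernel
    define a where "a = h d u"
    \<comment> \<open>The multiple of \<open>h d\<close> is chosen to make \<open>l' u = 0\<close>.
      If the old form represents \<open>l'\<close>, the part taken off is restored by adding a
      multiple of \<open>u\<close>, which only the new term sees.\<close>
    define l' where "l' f = l f - l u / a * h d f" for f
    have a: "a \<noteq> 0" using kernel by (simp add: a_def)
    have "l' (\<lambda>x. f x + k * w x) = l' f + k * l' w" for f k w
      by (simp add: l'_def insert.prems(2) h algebra_simps)
    then consider f where "\<And>\<phi>. ?Q f \<phi> = l' \<phi>" | f where "\<And>e. e \<in> A \<Longrightarrow> h e f = 0" "l' f \<noteq> 0"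
      using insert.IH[of l', OF c(2)] by blast
    then show ?thesis
    proof cases
      case 1
      define k where "k = (l u / a / c d - h d f) / a"
      have k: "c d * (h d f + k * a) = l u / a"
        using a c by (simp add: k_def)
      have "c d * h d (\<lambda>x. f x + k * u x) * h d \<phi> + ?Q (\<lambda>x. f x + k * u x) \<phi> = l \<phi>" for \<phi>
      proof -
        have "?Q u \<phi> = 0" using kernel by simp
        then show ?thesis
          unfolding Q_add 1 unfolding h a_def[symmetric] k by (simp add: l'_def)
      qed
      then show ?thesis unfolding ins by blast
    next
      case 2
      \<comment> \<open>The shift along \<open>u\<close> annihilates \<open>h d\<close>, and the
        value of \<open>l\<close> there is \<open>l' f\<close>.\<close>
      have "h e (\<lambda>x. f x + - (h d f / a) * u x) = 0" if "e \<in> insert d A" for e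
        using that 2(1)[of e] kernel(1)[of e] a unfolding h by (auto simp: a_def)
      moreover have "l (\<lambda>x. f x + - (h d f / a) * u x) \<noteq> 0"
        using 2(2) unfolding insert.prems(2) by (simp add: l'_def mult.commute)
      ultimately show ?thesis by blast
    qed
  qed
qed

text \<open>In a connected graph a function with zero gradient is constant on the vertices, so
  \<open>\<phi> p - \<phi> q\<close> vanishes on the kernel and only the first alternative is
  left.\<close>

lemma (in fin_digraph) unit_potential_exists:
  assumes "Digraph_Component.connected G" "\<And>e. e \<in> arcs G \<Longrightarrow> 0 < L e" "p \<in> verts G" "q \<in> verts G"
  obtains f where "\<And>\<phi>. dirichlet G L f \<phi> = \<phi> p - \<phi> q"
proof -
  have "(\<exists>f. \<forall>\<phi>. (\<Sum>e\<in>arcs G. (1 / L e) * grad G f e * grad G \<phi> e) = \<phi> p - \<phi> q)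
      \<or> (\<exists>f. (\<forall>e\<in>arcs G. grad G f e = 0) \<and> f p - f q \<noteq> 0)"
    using assms(2)
    by (intro quadratic_form_alternative) (auto simp: grad_def algebra_simps)
  moreover have "f p = f q" if "\<forall>e\<in>arcs G. grad G f e = 0" for f
    using connected_grad_eq_0[OF assms(1) _ assms(3,4), of f] that by blast
  ultimately obtain f where "\<And>\<phi>. (\<Sum>e\<in>arcs G. (1 / L e) * grad G f e * grad G \<phi> e) = \<phi> p - \<phi> q"
    by (metis diff_self)
  then show ?thesis
    by (intro that[of f]) (simp add: dirichlet_def)
qed

section \<open>Green functions\<close>

text \<open>The inverse of the grounded Laplacian, characterised by its properties and not
  constructed, so that the explicit update belonging to a contraction can be verified as another
  instance.\<close>

locale green = fin_digraph G for G :: "('a, 'b) pre_digraph" (structure) +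
  fixes L :: "'b \<Rightarrow> real" and z :: 'a and g :: "'a \<Rightarrow> 'a \<Rightarrow> real"
  assumes length_pos: "e \<in> arcs G \<Longrightarrow> 0 < L e"
    and base_in_verts: "z \<in> verts G"
    and g_base: "x \<in> verts G \<Longrightarrow> g x z = 0"
    and dirichlet_g: "x \<in> verts G \<Longrightarrow> dirichlet G L (g x) \<phi> = \<phi> x - \<phi> z"
begin

abbreviation "res x y \<equiv> g x x + g y y - 2 * g x y"

abbreviation "res_arc e \<equiv> res (tail G e) (head G e)"

abbreviation "minor e \<equiv> g (tail G e) (tail G e) * g (head G e) (head G e) - (g (tail G e) (head G e))\<^sup>2"

text \<open>Testing the equation of \<open>g x\<close> with \<open>g y\<close>, and conversely,
  evaluates one symmetric number in two ways.\<close>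

lemma g_commute: "x \<in> verts G \<Longrightarrow> y \<in> verts G \<Longrightarrow> g x y = g y x"
  using dirichlet_g[of x "g y"] dirichlet_g[of y "g x"] by (simp add: g_base dirichlet_commute)

lemma g_base_left: "x \<in> verts G \<Longrightarrow> g z x = 0"
  using g_commute[OF base_in_verts, of x] g_base[of x] by simp

end

lemma (in metrized_graph) green_exists:
  assumes z: "z \<in> verts G"
  obtains g where "green G L z g"
proof -
  have "\<exists>f. \<forall>\<phi>. dirichlet G L f \<phi> = \<phi> x - \<phi> z" if x: "x \<in> verts G" for x
  proof -
    obtain f where "\<And>\<phi>. dirichlet G L f \<phi> = \<phi> x - \<phi> z"
      using unit_potential_exists[of L x z] graph_connected length_pos x z by blast
    then show ?thesis by blast
  qed
  then obtain f where f: "\<And>x \<phi>. x \<in> verts G \<Longrightarrow> dirichlet G L (f x) \<phi> = \<phi> x - \<phi> z"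
    by metis
  have "green G L z (\<lambda>x y. f x y - f x z)"
  proof unfold_locales
    fix x \<phi> assume "x \<in> verts G"
    then show "dirichlet G L (\<lambda>y. f x y - f x z) \<phi> = \<phi> x - \<phi> z"
      using f[of x \<phi>] by (simp add: dirichlet_def grad_def)
  qed (auto simp: length_pos z)
  then show ?thesis by (rule that)
qed

context green
begin

lemma dirichlet_g_g: "x \<in> verts G \<Longrightarrow> y \<in> verts G \<Longrightarrow> dirichlet G L (g x) (g y) = g x y"
  using g_commute[of x y] by (simp add: dirichlet_g g_base)

abbreviation "drop_arc e x \<equiv> g (tail G e) x - g (head G e) x"

text \<open>By symmetry of \<open>g\<close>, \<open>drop_arc e x\<close> is minus the gradient of
  \<open>g x\<close> along \<open>e\<close>, so the sum is the energy pairing of \<open>g x\<close>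
  and \<open>g y\<close>. It serves to sum the rank one updates over all contracted arcs.\<close>

lemma sum_drop_arc:
  assumes "x \<in> verts G" "y \<in> verts G"
  shows "(\<Sum>e\<in>arcs G. drop_arc e x * drop_arc e y / L e) = g x y"
proof -
  have "grad G (g x) e * grad G (g y) e / L e = drop_arc e x * drop_arc e y / L e" if "e \<in> arcs G" for e
    using that assms g_commute[of x "tail G e"] g_commute[of x "head G e"]
      g_commute[of y "tail G e"] g_commute[of y "head G e"] by (simp add: grad_def algebra_simps)
  then have "dirichlet G L (g x) (g y) = (\<Sum>e\<in>arcs G. drop_arc e x * drop_arc e y / L e)"
    unfolding dirichlet_def by (intro sum.cong refl)
  then show ?thesis using assms by (simp add: dirichlet_g_g)
qed

text \<open>Kirchhoff's current law for \<open>g x\<close> at \<open>x\<close>, summed over \<open>x\<close> with weight \<open>\<psi>\<close>.  The case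
  \<open>\<psi> = 1\<close> is Foster's theorem.\<close>

lemma sum_diagonal_current:
  "(\<Sum>e\<in>arcs G. (\<psi> (tail G e) * (g (tail G e) (tail G e) - g (tail G e) (head G e))
      + \<psi> (head G e) * (g (head G e) (head G e) - g (tail G e) (head G e))) / L e)
   = (\<Sum>x\<in>verts G. \<psi> x) - \<psi> z"
proof -
  let ?\<delta> = "\<lambda>x y. if y = x then 1 else (0::real)"
  have "(\<Sum>x\<in>verts G. \<psi> x) - \<psi> z = (\<Sum>x\<in>verts G. \<psi> x) - (\<Sum>x\<in>verts G. if x = z then \<psi> x else 0)"
    using base_in_verts by simp
  \<comment> \<open>Tested with the indicator of \<open>x\<close>, the potential \<open>g x\<close>
    gives 1, except at \<open>x = z\<close>, where it gives 0.\<close>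
  also have "\<dots> = (\<Sum>x\<in>verts G. \<psi> x * dirichlet G L (g x) (?\<delta> x))"
    unfolding sum_subtractf[symmetric] by (intro sum.cong) (auto simp: dirichlet_g)
  also have "\<dots> = (\<Sum>e\<in>arcs G. \<Sum>x\<in>verts G. \<psi> x * grad G (g x) e * grad G (?\<delta> x) e / L e)"
    unfolding dirichlet_def sum_distrib_left by (subst sum.swap) (simp add: mult.assoc)
  also have "\<dots> = (\<Sum>e\<in>arcs G. (\<psi> (tail G e) * (g (tail G e) (tail G e) - g (tail G e) (head G e))
      + \<psi> (head G e) * (g (head G e) (head G e) - g (tail G e) (head G e))) / L e)"
  proof (rule sum.cong[OF refl])
    fix e assume e: "e \<in> arcs G"
    let ?a = "tail G e" and ?b = "head G e"
    have "(\<Sum>x\<in>verts G. \<psi> x * grad G (g x) e * grad G (?\<delta> x) e / L e)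
        = (\<Sum>x\<in>verts G. (if x = ?b then \<psi> x * grad G (g x) e / L e else 0))
          - (\<Sum>x\<in>verts G. (if x = ?a then \<psi> x * grad G (g x) e / L e else 0))"
      unfolding sum_subtractf[symmetric] by (intro sum.cong) (auto simp: grad_def)
    also have "\<dots> = \<psi> ?b * grad G (g ?b) e / L e - \<psi> ?a * grad G (g ?a) e / L e"
      using e by simp
    also have "\<dots> = (\<psi> ?a * (g ?a ?a - g ?a ?b) + \<psi> ?b * (g ?b ?b - g ?a ?b)) / L e"
      using g_commute[of ?a ?b] e
      by (simp add: grad_def diff_divide_distrib[symmetric] algebra_simps)
    finally show "(\<Sum>x\<in>verts G. \<psi> x * grad G (g x) e * grad G (?\<delta> x) e / L e)
        = (\<psi> ?a * (g ?a ?a - g ?a ?b) + \<psi> ?b * (g ?b ?b - g ?a ?b)) / L e" .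
  qed
  finally show ?thesis ..
qed

lemma foster: "(\<Sum>e\<in>arcs G. res_arc e / L e) = real (card (verts G)) - 1"
  using sum_diagonal_current[of "\<lambda>_. 1"] by (simp add: algebra_simps)

text \<open>The weight \<psi> x = \<open>g x x\<close> in the current law, together with the
  identity (p + q - 2w)^2 + 3(p - q)^2 = 4(p(p - w) + q(q - w) - (pq - w^2)). The left side is the
  combination that the integral for tau produces.\<close>

lemma sum_res_squared:
  "(\<Sum>e\<in>arcs G. ((res_arc e)\<^sup>2 + 3 * (grad G (\<lambda>x. g x x) e)\<^sup>2) / L e)
   = 4 * ((\<Sum>x\<in>verts G. g x x) - (\<Sum>e\<in>arcs G. minor e / L e))"
proof -
  have "(\<Sum>e\<in>arcs G. ((res_arc e)\<^sup>2 + 3 * (grad G (\<lambda>x. g x x) e)\<^sup>2) / L e)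
      = 4 * (\<Sum>e\<in>arcs G. (g (tail G e) (tail G e) * (g (tail G e) (tail G e) - g (tail G e) (head G e))
      + g (head G e) (head G e) * (g (head G e) (head G e) - g (tail G e) (head G e))) / L e)
      - 4 * (\<Sum>e\<in>arcs G. minor e / L e)"
    unfolding sum_distrib_left sum_subtractf[symmetric]
  proof (rule sum.cong[OF refl])
    fix e
    show "((res_arc e)\<^sup>2 + 3 * (grad G (\<lambda>x. g x x) e)\<^sup>2) / L e
      = 4 * ((g (tail G e) (tail G e) * (g (tail G e) (tail G e) - g (tail G e) (head G e))
      + g (head G e) (head G e) * (g (head G e) (head G e) - g (tail G e) (head G e))) / L e)
      - 4 * (minor e / L e)"
      unfolding grad_def times_divide_eq_right diff_divide_distrib[symmetric]
      by (rule arg_cong[where f = "\<lambda>u. u / L e"]) (simp add: power2_eq_square algebra_simps)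
  qed
  then show ?thesis
    using sum_diagonal_current[of "\<lambda>x. g x x"] by (simp add: g_base base_in_verts)
qed

section \<open>Resistance across an arc and deletion of the arc\<close>

lemma dirichlet_g_diff:
  assumes "x \<in> verts G" "y \<in> verts G"
  shows "dirichlet G L (\<lambda>u. g x u - g y u) \<phi> = \<phi> x - \<phi> y"
  using assms by (simp add: dirichlet_linear dirichlet_g)

text \<open>\<open>res x y\<close> is the energy of the unit flow from \<open>x\<close> to
  \<open>y\<close>. Without positive energy every gradient vanishes, and no current could leave
  \<open>x\<close>.\<close>

lemma res_pos:
  assumes "x \<in> verts G" "y \<in> verts G" "x \<noteq> y"
  shows "0 < res x y"
proof (rule ccontr)
  assume *: "\<not> 0 < res x y"
  let ?h = "\<lambda>u. g x u - g y u"
  have "dirichlet G L ?h ?h \<le> 0"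
    using * g_commute[of x y] assms by (simp add: dirichlet_g_diff)
  then have "grad G ?h e = 0" if "e \<in> arcs G" for e
    using dirichlet_eq_0D length_pos that by blast
  then have "dirichlet G L ?h (\<lambda>u. if u = x then 1 else 0) = 0"
    by (simp add: dirichlet_def)
  then show False
    using assms by (simp add: dirichlet_g_diff)
qed

text \<open>Removing an arc scales the current of \<open>g (tail G e) - g (head G e)\<close> by \<open>1 - res_arc e / L e\<close>.\<close>

lemma arc_res_eq:
  assumes e: "e \<in> arcs G" and less: "res_arc e < L e"
  shows "arc_res G L e / (L e + arc_res G L e) = res_arc e / L e"
proof -
  let ?a = "tail G e" and ?b = "head G e" and ?H = "pre_digraph.del_arc G e"
  let ?h = "\<lambda>u. g ?a u - g ?b u"
  let ?s = "1 - res_arc e / L e"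
  have L: "0 < L e" using length_pos e .
  interpret H: fin_digraph ?H by (rule fin_digraph_del_arc)
  have s: "0 < ?s" using less L by simp
  have dir_H: "dirichlet ?H L ?h \<phi> = ?s * (\<phi> ?a - \<phi> ?b)" for \<phi>
  proof -
    have "dirichlet ?H L ?h \<phi> = (\<Sum>d\<in>arcs G - {e}. grad G ?h d * grad G \<phi> d / L d)"
      by (simp add: dirichlet_def grad_def)
    also have "\<dots> = dirichlet G L ?h \<phi> - grad G ?h e * grad G \<phi> e / L e"
      using e by (simp add: dirichlet_def sum_diff1)
    also have "\<dots> = ?s * (\<phi> ?a - \<phi> ?b)"
      using e L g_commute[of ?a ?b] by (simp add: dirichlet_g_diff) (simp add: grad_def field_simps)
    finally show ?thesis .
  qed
  have cancel: "1 / k * (k * x) = x" if "0 < k" for k x :: real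
    using that by simp
  have "eff_res ?H L ?a ?b = (1 / ?s) * ?h ?a - (1 / ?s) * ?h ?b"
  proof (rule H.eff_res_eq)
    fix \<phi>
    show "dirichlet ?H L (\<lambda>u. (1 / ?s) * ?h u) \<phi> = \<phi> ?a - \<phi> ?b"
      unfolding dirichlet_cmult_left dir_H by (rule cancel[OF s])
  qed (use e in auto)
  also have "\<dots> = res_arc e / ?s"
    using g_commute[of ?a ?b] e by (simp add: diff_divide_distrib[symmetric])
  finally have "arc_res G L e = res_arc e / ?s"
    by (simp add: arc_res_def)
  \<comment> \<open>The parallel law for \<open>e\<close> and the rest of the graph, solved for the
    resistance of the rest.\<close>
  moreover have "res_arc e / ?s = L e * res_arc e / (L e - res_arc e)"
    using L less by (simp add: field_simps)
  moreover have "R / (L e + R) = r / L e" if "R = L e * r / (L e - r)" "r < L e" for R r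
  proof -
    have "L e + R = L e * L e / (L e - r)"
      using that L by (simp add: field_simps)
    then show ?thesis using that L by simp
  qed
  ultimately show ?thesis
    using less by metis
qed

text \<open>Bridgelessness enters through this inequality. On the graph without \<open>e\<close> the
  potential has energy \<open>res_arc e * (1 - res_arc e / L e)\<close>; if that were not positive,
  the potential would be constant there, forcing \<open>res_arc e = 0\<close>.\<close>

lemma res_arc_less:
  assumes e: "e \<in> arcs G" and con: "Digraph_Component.connected (pre_digraph.del_arc G e)"
  shows "res_arc e < L e"
proof (rule ccontr)
  assume *: "\<not> res_arc e < L e"
  let ?a = "tail G e" and ?b = "head G e" and ?H = "pre_digraph.del_arc G e"
  let ?h = "\<lambda>u. g ?a u - g ?b u"
  have L: "0 < L e" using length_pos e .
  interpret H: fin_digraph ?H by (rule fin_digraph_del_arc)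
  have grad_h: "grad G ?h e = - res_arc e"
    using e g_commute[of ?a ?b] by (simp add: grad_def)
  have "dirichlet ?H L ?h ?h = (\<Sum>d\<in>arcs G - {e}. grad G ?h d * grad G ?h d / L d)"
    by (simp add: dirichlet_def grad_def)
  also have "\<dots> = dirichlet G L ?h ?h - grad G ?h e * grad G ?h e / L e"
    using e by (simp add: dirichlet_def sum_diff1)
  also have "\<dots> = res_arc e * (1 - res_arc e / L e)"
    unfolding grad_h using e g_commute[of ?a ?b] by (simp add: dirichlet_g_diff algebra_simps)
  also have "\<dots> \<le> 0"
    using * L by (intro mult_nonneg_nonpos) auto
  finally have "grad ?H ?h d = 0" if "d \<in> arcs ?H" for d
    using that by (intro H.dirichlet_eq_0D[of L]) (auto intro: length_pos)
  then have "?h ?a = ?h ?b"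
    using con e by (intro connected_grad_eq_0[of ?H]) auto
  then have "res_arc e = 0"
    using e g_commute[of ?a ?b] by simp
  then show False using * L by simp
qed

end


section \<open>Contractions\<close>

text \<open>
  In combinatorial terms this is \<open>(\<Sum>F. (n F - 2) * w F) / Z\<close> over the spanning forests \<open>F\<close> with two
  components, where \<open>n F\<close> arcs join the components, \<open>w F\<close> is the product of the \<open>1 / L e\<close> and \<open>Z\<close> is
  the weight of all spanning trees.  Only the expression through the Green function is used.
\<close>

definition contraction_value ::
    "('a, 'b) pre_digraph \<Rightarrow> ('b \<Rightarrow> real) \<Rightarrow> ('a \<Rightarrow> 'a \<Rightarrow> real) \<Rightarrow> real" where
  "contraction_value G L g =
    (\<Sum>e\<in>arcs G. g (tail G e) (tail G e) + g (head G e) (head G e) - 2 * g (tail G e) (head G e))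
    - 2 * ((\<Sum>x\<in>verts G. g x x)
      - (\<Sum>e\<in>arcs G. (g (tail G e) (tail G e) * g (head G e) (head G e) - (g (tail G e) (head G e))\<^sup>2) / L e))"

text \<open>The Sherman-Morrison update of \<open>g\<close> in the limit where the conductance of
  \<open>e\<close> tends to infinity.\<close>

definition contract_green ::
    "('a, 'b) pre_digraph \<Rightarrow> 'b \<Rightarrow> ('a \<Rightarrow> 'a \<Rightarrow> real) \<Rightarrow> 'a \<Rightarrow> 'a \<Rightarrow> real" where
  "contract_green G e g x y = g x y
    - (g (tail G e) x - g (head G e) x) * (g (tail G e) y - g (head G e) y)
      / (g (tail G e) (tail G e) + g (head G e) (head G e) - 2 * g (tail G e) (head G e))"

definition merge_ends :: "('a, 'b) pre_digraph \<Rightarrow> 'b \<Rightarrow> 'a \<Rightarrow> 'a" where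
  "merge_ends G e x = (if x = head G e then tail G e else x)"

lemma contract_arc_simps:
  "verts (contract_arc G e) = merge_ends G e ` verts G"
  "arcs (contract_arc G e) = arcs G - {e}"
  "tail (contract_arc G e) d = merge_ends G e (tail G d)"
  "head (contract_arc G e) d = merge_ends G e (head G d)"
  by (simp_all add: contract_arc_def merge_ends_def Let_def)

section \<open>The Green function of a contracted graph\<close>

context green
begin

context
  fixes e assumes e: "e \<in> arcs G" and nonloop: "tail G e \<noteq> head G e"
begin

abbreviation (input) "g' \<equiv> contract_green G e g"
abbreviation (input) "m \<equiv> merge_ends G e"

lemma res_arc_pos: "0 < res_arc e"
  using res_pos e nonloop by simp

lemma merge_image: "m ` verts G = verts G - {head G e}"
  using e nonloop by (auto simp: merge_ends_def image_iff)

lemma merge_in_verts: "x \<in> verts G \<Longrightarrow> m x \<in> verts G"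
  using e by (simp add: merge_ends_def)

lemma contract_green_eq: "g' x y = g x y - drop_arc e x * drop_arc e y / res_arc e"
  by (simp add: contract_green_def)

lemma contract_green_commute: "x \<in> verts G \<Longrightarrow> y \<in> verts G \<Longrightarrow> g' x y = g' y x"
  using g_commute[of x y] by (simp add: contract_green_eq mult.commute)

text \<open>The update makes the merged ends indistinguishable: \<open>drop_arc e\<close> differs by
  exactly \<open>res_arc e\<close> between tail and head, so the correction cancels
  \<open>drop_arc e x\<close>.\<close>

lemma contract_green_merge_right: 
  assumes "x \<in> verts G"
  shows "g' x (m y) = g' x y"
proof (cases "y = head G e")
  case True
  have "drop_arc e (tail G e) - drop_arc e (head G e) = res_arc e"
    using g_commute[of "tail G e" "head G e"] e by simp
  then have "drop_arc e x * drop_arc e (tail G e) / res_arc e - drop_arc e x * drop_arc e (head G e) / res_arc e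
     = drop_arc e x"
    unfolding diff_divide_distrib[symmetric] right_diff_distrib[symmetric]
    using res_arc_pos by simp
  then show ?thesis
    using True assms e g_commute[of x "tail G e"] g_commute[of x "head G e"]
    by (simp add: merge_ends_def contract_green_eq)
qed (simp add: merge_ends_def)

lemma contract_green_merge:
  assumes "x \<in> verts G" "y \<in> verts G"
  shows "g' (m x) (m y) = g' x y"
  using assms contract_green_merge_right[of "m x" y] contract_green_merge_right[of y x]
    contract_green_commute[of "m x" y] contract_green_commute[of x y]
  by (simp add: merge_in_verts)

lemma green_contract: "green (contract_arc G e) L (m z) g'"
proof unfold_locales
  fix x \<phi> assume x: "x \<in> verts (contract_arc G e)"
  then have x': "x \<in> verts G" "m x = x"
    unfolding contract_arc_simps merge_image by (auto simp: merge_ends_def)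
  show "g' x (m z) = 0"
    unfolding contract_green_merge_right[OF x'(1)]
    using x' e by (simp add: contract_green_eq g_base)
  have "dirichlet (contract_arc G e) L (g' x) \<phi>
     = (\<Sum>d\<in>arcs G - {e}. grad G (g' x) d * grad G (\<lambda>y. \<phi> (m y)) d / L d)"
    unfolding dirichlet_def grad_def contract_arc_simps contract_green_merge_right[OF x'(1)] ..
  \<comment> \<open>The arc \<open>e\<close> may be put back because the test function
    \<open>\<phi> (m y)\<close> agrees at its ends. For the same reason the rank one correction
    contributes nothing below.\<close>
  also have "\<dots> = dirichlet G L (g' x) (\<lambda>y. \<phi> (m y))"
    using e by (simp add: dirichlet_def sum_diff1) (simp add: grad_def merge_ends_def)
  also have "\<dots> = dirichlet G L (\<lambda>y. g x y - (drop_arc e x / res_arc e) * drop_arc e y) (\<lambda>y. \<phi> (m y))"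
    by (simp add: contract_green_eq[abs_def])
  also have "\<dots> = \<phi> x - \<phi> (m z)"
    unfolding dirichlet_diff_left dirichlet_cmult_left
    using x' e by (simp add: dirichlet_g dirichlet_g_diff) (simp add: merge_ends_def)
  finally show "dirichlet (contract_arc G e) L (g' x) \<phi> = \<phi> x - \<phi> (m z)" .
qed (auto simp: contract_arc_simps length_pos base_in_verts)

text \<open>Rayleigh monotonicity: the loss is a square over \<open>res_arc e\<close>. It lets
  \<open>res_arc d < L d\<close> pass to contractions.\<close>

lemma res_arc_contract_le:
  assumes "d \<in> arcs G"
  shows "green.res_arc (contract_arc G e) g' d \<le> res_arc d"
proof -
  have d: "tail G d \<in> verts G" "head G d \<in> verts G" using assms by auto
  have "0 \<le> (drop_arc e (tail G d) - drop_arc e (head G d))\<^sup>2 / res_arc e"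
    using res_arc_pos by simp
  also have "\<dots> = res_arc d - green.res_arc (contract_arc G e) g' d"
    unfolding contract_arc_simps
    unfolding contract_green_merge[OF d(1) d(1)] contract_green_merge[OF d(1) d(2)]
      contract_green_merge[OF d(2) d(2)]
    unfolding contract_green_eq
    by (simp add: power2_eq_square add_divide_distrib[symmetric] diff_divide_distrib[symmetric] algebra_simps)
  finally show ?thesis by simp
qed

end

section \<open>Summing the contracted values over all arcs\<close>

text \<open>The value of the contraction at \<open>e\<close>, multiplied by \<open>res_arc e\<close>: the last sum consists of
  Gram determinants of three functionals, so the term of \<open>e\<close> itself vanishes.\<close>

definition contracted :: "'b \<Rightarrow> real" where
  "contracted e = (\<Sum>d\<in>arcs G. res_arc e * res_arc d - (drop_arc e (tail G d) - drop_arc e (head G d))\<^sup>2)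
    - 2 * ((\<Sum>x\<in>verts G. res_arc e * g x x - (drop_arc e x)\<^sup>2) - minor e
      - (\<Sum>d\<in>arcs G. (res_arc e * minor d
          - (g (tail G d) (tail G d) * (drop_arc e (head G d))\<^sup>2
            + g (head G d) (head G d) * (drop_arc e (tail G d))\<^sup>2
            - 2 * g (tail G d) (head G d) * drop_arc e (tail G d) * drop_arc e (head G d))) / L d))"

lemma contracted_loop: "tail G e = head G e \<Longrightarrow> contracted e = 0"
  by (simp add: contracted_def power2_eq_square)

lemma contracted_nonloop:
  assumes e: "e \<in> arcs G" and nonloop: "tail G e \<noteq> head G e"
  shows "res_arc e * contraction_value (contract_arc G e) L (contract_green G e g) = contracted e"
proof -
  let ?a = "tail G e" and ?b = "head G e" and ?g' = "contract_green G e g"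
  note eq = contract_green_eq[OF e nonloop] and mrg = contract_green_merge[OF e nonloop]
  let ?r = "res_arc e"
  have r: "?r \<noteq> 0" using res_pos[of ?a ?b] e nonloop by simp
  have comm: "g ?b ?a = g ?a ?b" using g_commute[of ?a ?b] e by simp
  have r_g: "?r * ?g' x y = ?r * g x y - drop_arc e x * drop_arc e y" for x y
    unfolding eq right_diff_distrib using r by simp
  have "?r * (\<Sum>d\<in>arcs G - {e}. ?g' (tail G d) (tail G d) + ?g' (head G d) (head G d) - 2 * ?g' (tail G d) (head G d))
     = (\<Sum>d\<in>arcs G - {e}. ?r * res_arc d - (drop_arc e (tail G d) - drop_arc e (head G d))\<^sup>2)"
    unfolding sum_distrib_left
  proof (rule sum.cong[OF refl])
    fix d
    have "?r * (?g' (tail G d) (tail G d) + ?g' (head G d) (head G d) - 2 * ?g' (tail G d) (head G d))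
       = ?r * ?g' (tail G d) (tail G d) + ?r * ?g' (head G d) (head G d) - 2 * (?r * ?g' (tail G d) (head G d))"
      by (simp add: algebra_simps)
    also have "\<dots> = ?r * res_arc d - (drop_arc e (tail G d) - drop_arc e (head G d))\<^sup>2"
      unfolding r_g power2_eq_square by algebra
    finally show "?r * (?g' (tail G d) (tail G d) + ?g' (head G d) (head G d) - 2 * ?g' (tail G d) (head G d))
       = ?r * res_arc d - (drop_arc e (tail G d) - drop_arc e (head G d))\<^sup>2" .
  qed
  \<comment> \<open>The added term \<open>d = e\<close> is zero, since the drop difference along
    \<open>e\<close> is \<open>res_arc e\<close>.\<close>
  also have "\<dots> = (\<Sum>d\<in>arcs G. ?r * res_arc d - (drop_arc e (tail G d) - drop_arc e (head G d))\<^sup>2)"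
    using e comm by (simp add: sum_diff1 power2_eq_square algebra_simps)
  finally have 1: "?r * (\<Sum>d\<in>arcs G - {e}. ?g' (tail G d) (tail G d) + ?g' (head G d) (head G d)
        - 2 * ?g' (tail G d) (head G d))
     = (\<Sum>d\<in>arcs G. ?r * res_arc d - (drop_arc e (tail G d) - drop_arc e (head G d))\<^sup>2)" .
  have "?r * (\<Sum>x\<in>verts G - {?b}. ?g' x x) = (\<Sum>x\<in>verts G - {?b}. ?r * g x x - (drop_arc e x)\<^sup>2)"
    unfolding sum_distrib_left r_g power2_eq_square ..
  \<comment> \<open>The contracted graph lacks the vertex \<open>head G e\<close>; its term equals
    \<open>minor e\<close>, which explains the separate \<open>minor e\<close> in
    \<open>contracted\<close>.\<close>
  also have "\<dots> = (\<Sum>x\<in>verts G. ?r * g x x - (drop_arc e x)\<^sup>2) - (?r * g ?b ?b - (drop_arc e ?b)\<^sup>2)"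
    using e by (simp add: sum_diff1)
  also have "?r * g ?b ?b - (drop_arc e ?b)\<^sup>2 = minor e"
    unfolding comm power2_eq_square by algebra
  finally have 2: "?r * (\<Sum>x\<in>verts G - {?b}. ?g' x x)
     = (\<Sum>x\<in>verts G. ?r * g x x - (drop_arc e x)\<^sup>2) - minor e" .
  have cancel: "?r * (X / l) = Y / l" if "?r * (?r * X) = ?r * Y" for X Y l
    using that r by (simp only: mult_cancel_left times_divide_eq_right) simp
  \<comment> \<open>Sylvester's determinant identity: the 2 by 2 determinant of the updated entries
    is \<open>R\<close> times the 3 by 3 Gram determinant.\<close>
  have gram: "(R * p - s * s) * (R * q - u * u) - (R * w - s * u)\<^sup>2
      = R * (R * (p * q - w\<^sup>2) - (p * u\<^sup>2 + q * s\<^sup>2 - 2 * w * s * u))" for R p q w s u :: real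
    by algebra
  let ?M = "\<lambda>d. (?r * minor d
          - (g (tail G d) (tail G d) * (drop_arc e (head G d))\<^sup>2
            + g (head G d) (head G d) * (drop_arc e (tail G d))\<^sup>2
            - 2 * g (tail G d) (head G d) * drop_arc e (tail G d) * drop_arc e (head G d))) / L d"
  have "?r * (\<Sum>d\<in>arcs G - {e}. (?g' (tail G d) (tail G d) * ?g' (head G d) (head G d)
       - (?g' (tail G d) (head G d))\<^sup>2) / L d) = (\<Sum>d\<in>arcs G - {e}. ?M d)"
    unfolding sum_distrib_left
  proof (rule sum.cong[OF refl])
    fix d
    have "?r * (?r * (?g' (tail G d) (tail G d) * ?g' (head G d) (head G d) - (?g' (tail G d) (head G d))\<^sup>2))
      = (?r * ?g' (tail G d) (tail G d)) * (?r * ?g' (head G d) (head G d)) - (?r * ?g' (tail G d) (head G d))\<^sup>2"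
      by (simp add: power2_eq_square algebra_simps)
    also have "\<dots> = ?r * (?r * minor d
          - (g (tail G d) (tail G d) * (drop_arc e (head G d))\<^sup>2
            + g (head G d) (head G d) * (drop_arc e (tail G d))\<^sup>2
            - 2 * g (tail G d) (head G d) * drop_arc e (tail G d) * drop_arc e (head G d)))"
      unfolding r_g by (rule gram)
    finally show "?r * ((?g' (tail G d) (tail G d) * ?g' (head G d) (head G d)
       - (?g' (tail G d) (head G d))\<^sup>2) / L d) = ?M d"
      by (rule cancel)
  qed
  also have "\<dots> = (\<Sum>d\<in>arcs G. ?M d)"
  proof -
    have "?M e = 0"
      unfolding comm power2_eq_square by (simp add: algebra_simps)
    then show ?thesis using e by (simp add: sum_diff1)
  qed
  finally have 3: "?r * (\<Sum>d\<in>arcs G - {e}. (?g' (tail G d) (tail G d) * ?g' (head G d) (head G d)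
       - (?g' (tail G d) (head G d))\<^sup>2) / L d) = (\<Sum>d\<in>arcs G. ?M d)" .
  have "contraction_value (contract_arc G e) L ?g'
    = (\<Sum>d\<in>arcs G - {e}. ?g' (tail G d) (tail G d) + ?g' (head G d) (head G d) - 2 * ?g' (tail G d) (head G d))
    - 2 * ((\<Sum>x\<in>verts G - {?b}. ?g' x x)
      - (\<Sum>d\<in>arcs G - {e}. (?g' (tail G d) (tail G d) * ?g' (head G d) (head G d)
       - (?g' (tail G d) (head G d))\<^sup>2) / L d))"
    unfolding contraction_value_def contract_arc_simps merge_image[OF e nonloop] by (simp add: mrg)
  moreover have "u * (a - 2 * (b - c)) = u * a - 2 * (u * b - u * c)" for u a b c :: real
    by (simp add: algebra_simps)
  ultimately show ?thesis
    by (simp only: contracted_def 1 2 3)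
qed

text \<open>Foster's theorem turns each \<open>res_arc e\<close> into v - 1, and
  \<open>sum_drop_arc\<close> turns products of drops back into \<open>g\<close>. The resistance and
  diagonal sums acquire the factor v - 2; the determinant sum acquires v - 3, and the separate
  \<open>minor e\<close> supplies the missing one.\<close>

lemma sum_contracted:
  "(\<Sum>e\<in>arcs G. contracted e / L e) = (real (card (verts G)) - 2) * contraction_value G L g"
proof -
  let ?A = "arcs G" and ?n = "real (card (verts G)) - 1"
  let ?t = "\<lambda>d. tail G d" and ?h = "\<lambda>d. head G d"
  have F: "(\<Sum>e\<in>?A. res_arc e * c / L e) = ?n * c" for c
    unfolding foster[symmetric] sum_distrib_right by simp
  have 1: "(\<Sum>e\<in>?A. (\<Sum>d\<in>?A. res_arc e * res_arc d - (drop_arc e (?t d) - drop_arc e (?h d))\<^sup>2) / L e)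
     = (?n - 1) * (\<Sum>d\<in>?A. res_arc d)"
    unfolding sum_divide_distrib sum_distrib_left
  proof (subst sum.swap, rule sum.cong[OF refl])
    fix d assume d: "d \<in> ?A"
    have "(\<Sum>e\<in>?A. (res_arc e * res_arc d - (drop_arc e (?t d) - drop_arc e (?h d))\<^sup>2) / L e)
      = (\<Sum>e\<in>?A. res_arc e * res_arc d / L e) - ((\<Sum>e\<in>?A. drop_arc e (?t d) * drop_arc e (?t d) / L e)
        + (\<Sum>e\<in>?A. drop_arc e (?h d) * drop_arc e (?h d) / L e)
        - 2 * (\<Sum>e\<in>?A. drop_arc e (?t d) * drop_arc e (?h d) / L e))"
      unfolding sum_distrib_left sum.distrib[symmetric] sum_subtractf[symmetric]
      by (intro sum.cong refl)
         (simp add: power2_eq_square add_divide_distrib[symmetric] diff_divide_distrib[symmetric] algebra_simps)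
    then show "(\<Sum>e\<in>?A. (res_arc e * res_arc d - (drop_arc e (?t d) - drop_arc e (?h d))\<^sup>2) / L e)
      = (?n - 1) * res_arc d"
      using d by (simp only: F sum_drop_arc tail_in_verts head_in_verts) (simp add: algebra_simps)
  qed
  have 2: "(\<Sum>e\<in>?A. (\<Sum>x\<in>verts G. res_arc e * g x x - (drop_arc e x)\<^sup>2) / L e)
     = (?n - 1) * (\<Sum>x\<in>verts G. g x x)"
    unfolding sum_divide_distrib sum_distrib_left
  proof (subst sum.swap, rule sum.cong[OF refl])
    fix x assume x: "x \<in> verts G"
    have "(\<Sum>e\<in>?A. (res_arc e * g x x - (drop_arc e x)\<^sup>2) / L e)
      = (\<Sum>e\<in>?A. res_arc e * g x x / L e) - (\<Sum>e\<in>?A. drop_arc e x * drop_arc e x / L e)"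
      by (simp add: power2_eq_square diff_divide_distrib sum_subtractf)
    then show "(\<Sum>e\<in>?A. (res_arc e * g x x - (drop_arc e x)\<^sup>2) / L e) = (?n - 1) * g x x"
      using x by (simp only: F sum_drop_arc) (simp add: algebra_simps)
  qed
  have 3: "(\<Sum>e\<in>?A. (\<Sum>d\<in>?A. (res_arc e * minor d
          - (g (?t d) (?t d) * (drop_arc e (?h d))\<^sup>2 + g (?h d) (?h d) * (drop_arc e (?t d))\<^sup>2
            - 2 * g (?t d) (?h d) * drop_arc e (?t d) * drop_arc e (?h d))) / L d) / L e)
     = (?n - 2) * (\<Sum>d\<in>?A. minor d / L d)"
    unfolding sum_divide_distrib sum_distrib_left
  proof (subst sum.swap, rule sum.cong[OF refl])
    fix d assume d: "d \<in> ?A"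
    let ?T = "\<lambda>e. res_arc e * minor d
          - (g (?t d) (?t d) * (drop_arc e (?h d))\<^sup>2 + g (?h d) (?h d) * (drop_arc e (?t d))\<^sup>2
            - 2 * g (?t d) (?h d) * drop_arc e (?t d) * drop_arc e (?h d))"
    have "(\<Sum>e\<in>?A. ?T e / L e)
      = (\<Sum>e\<in>?A. res_arc e * minor d / L e)
        - (g (?t d) (?t d) * (\<Sum>e\<in>?A. drop_arc e (?h d) * drop_arc e (?h d) / L e)
        + g (?h d) (?h d) * (\<Sum>e\<in>?A. drop_arc e (?t d) * drop_arc e (?t d) / L e)
        - 2 * g (?t d) (?h d) * (\<Sum>e\<in>?A. drop_arc e (?t d) * drop_arc e (?h d) / L e))"
      unfolding sum_distrib_left sum.distrib[symmetric] sum_subtractf[symmetric]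
      by (intro sum.cong refl)
         (simp add: power2_eq_square add_divide_distrib diff_divide_distrib mult.assoc)
    also have "\<dots> = (?n - 2) * minor d"
      using d by (simp only: F sum_drop_arc tail_in_verts head_in_verts)
        (simp add: power2_eq_square algebra_simps)
    finally have T: "(\<Sum>e\<in>?A. ?T e / L e) = (?n - 2) * minor d" .
    have "(\<Sum>e\<in>?A. ?T e / L d / L e) = (\<Sum>e\<in>?A. ?T e / L e) / L d"
      unfolding sum_divide_distrib by (intro sum.cong refl) (simp add: mult.commute)
    then show "(\<Sum>e\<in>?A. ?T e / L d / L e) = (?n - 2) * (minor d / L d)"
      unfolding T by simp
  qed
  define A where "A e = (\<Sum>d\<in>?A. res_arc e * res_arc d - (drop_arc e (?t d) - drop_arc e (?h d))\<^sup>2)" for e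
  define B where "B e = (\<Sum>x\<in>verts G. res_arc e * g x x - (drop_arc e x)\<^sup>2)" for e
  define C where "C e = (\<Sum>d\<in>?A. (res_arc e * minor d
          - (g (?t d) (?t d) * (drop_arc e (?h d))\<^sup>2 + g (?h d) (?h d) * (drop_arc e (?t d))\<^sup>2
            - 2 * g (?t d) (?h d) * drop_arc e (?t d) * drop_arc e (?h d))) / L d)" for e
  have "(\<Sum>e\<in>?A. contracted e / L e)
      = (\<Sum>e\<in>?A. A e / L e) - 2 * ((\<Sum>e\<in>?A. B e / L e) - (\<Sum>e\<in>?A. minor e / L e) - (\<Sum>e\<in>?A. C e / L e))"
    unfolding contracted_def A_def[symmetric] B_def[symmetric] C_def[symmetric]
      sum_distrib_left sum_subtractf[symmetric]
    by (intro sum.cong refl) (simp add: diff_divide_distrib)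
  then show ?thesis
    using 1[folded A_def] 2[folded B_def] 3[folded C_def]
    by (simp only: contraction_value_def) (simp add: algebra_simps)
qed

text \<open>Grounding leaves one nonzero entry \<rho> of \<open>g\<close> on the vertices, and all
  minors vanish. Foster's theorem identifies \<rho> with the parallel resistance; every nonloop has
  resistance \<rho>, and the diagonal sum accounts for the -2.\<close>

lemma contraction_value_two_vertices:
  assumes "card (verts G) = 2"
  shows "contraction_value G L g = (real (card (nonloops G)) - 2) * parallel_res G L"
proof -
  obtain y where V: "verts G = {z, y}" "y \<noteq> z"
  proof -
    obtain x y where xy: "verts G = {x, y}" "x \<noteq> y"
      using assms by (auto simp: card_2_iff)
    then have "z = x \<or> z = y" using base_in_verts by auto
    then show ?thesis using that[of x] that[of y] xy by (auto simp: insert_commute)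
  qed
  define \<rho> where "\<rho> = g y y"
  have g: "g z z = 0" "g z y = 0" "g y z = 0"
    using V by (auto simp: g_base g_base_left)
  have ends: "tail G e = z \<and> head G e = z \<or> tail G e = z \<and> head G e = y
      \<or> tail G e = y \<and> head G e = z \<or> tail G e = y \<and> head G e = y" if "e \<in> arcs G" for e
    using that V(1) tail_in_verts[of e] head_in_verts[of e] by blast
  have r: "res_arc e = (if e \<in> nonloops G then \<rho> else 0)" if "e \<in> arcs G" for e
    using ends[OF that] by (elim disjE conjE) (simp_all add: nonloops_def g \<rho>_def that V(2) V(2)[symmetric])
  have M: "minor e = 0" if "e \<in> arcs G" for e
    using ends[OF that] by (elim disjE conjE) (simp_all add: g power2_eq_square)
  have nl: "nonloops G \<subseteq> arcs G" by (auto simp: nonloops_def)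
  have sum_nl: "(\<Sum>e\<in>arcs G. if e \<in> nonloops G then f e else 0) = (\<Sum>e\<in>nonloops G. f e)" for f :: "'b \<Rightarrow> real"
    using nl by (simp add: sum.inter_restrict[symmetric] Int_absorb1)
  have "1 = (\<Sum>e\<in>arcs G. res_arc e / L e)"
    using foster assms by simp
  also have "\<dots> = (\<Sum>e\<in>arcs G. if e \<in> nonloops G then \<rho> * (1 / L e) else 0)"
    by (intro sum.cong) (auto simp: r)
  also have "\<dots> = \<rho> * (\<Sum>e\<in>nonloops G. 1 / L e)"
    by (simp add: sum_nl sum_distrib_left)
  finally have "parallel_res G L = \<rho>"
    unfolding parallel_res_def by (metis inverse_unique mult.commute)
  moreover have "(\<Sum>e\<in>arcs G. res_arc e) = real (card (nonloops G)) * \<rho>"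
  proof -
    have "(\<Sum>e\<in>arcs G. res_arc e) = (\<Sum>e\<in>arcs G. if e \<in> nonloops G then \<rho> else 0)"
      by (intro sum.cong) (auto simp: r)
    then show ?thesis by (simp add: sum_nl)
  qed
  moreover have "(\<Sum>x\<in>verts G. g x x) = \<rho>"
    using V by (simp add: g \<rho>_def)
  moreover have "(\<Sum>e\<in>arcs G. minor e / L e) = 0"
    by (intro sum.neutral ballI) (simp only: M div_0)
  ultimately show ?thesis
    by (simp add: contraction_value_def algebra_simps)
qed

end

text \<open>The induction carries the inequality \<open>res_arc e < L e\<close>, which contraction
  preserves. Contracting a loop keeps the vertex count, so the induction hypothesis does not apply
  there, but its coefficient is 0. The factor v - 2 = k + 1 completes the factorial.\<close>

lemma contraction_sum_eq:
  assumes "green G L z g"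
    and "\<And>e. e \<in> arcs G \<Longrightarrow> green.res_arc G g e < L e"
    and "card (verts G) = k + 2"
  shows "contraction_sum k G L = fact k * contraction_value G L g"
  using assms
proof (induction k arbitrary: G z g)
  case 0
  then show ?case
    by (simp add: green.contraction_value_two_vertices admissible_def)
next
  case (Suc k)
  interpret green G L z g by fact
  have "arc_res G L e / (L e + arc_res G L e) * contraction_sum k (contract_arc G e) L
      = fact k * (contracted e / L e)" if e: "e \<in> arcs G" for e
  proof (cases "tail G e = head G e")
    case True
    then show ?thesis
      unfolding arc_res_eq[OF e Suc.prems(2)[OF e]] using contracted_loop[of e] by simp
  next
    case False
    have "contraction_sum k (contract_arc G e) L
        = fact k * contraction_value (contract_arc G e) L (contract_green G e g)"
    proof (rule Suc.IH)
      show "green (contract_arc G e) L (merge_ends G e z) (contract_green G e g)"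
        using e False by (rule green_contract)
      show "green.res_arc (contract_arc G e) (contract_green G e g) d < L d"
        if "d \<in> arcs (contract_arc G e)" for d
        using that res_arc_contract_le[OF e False, of d] Suc.prems(2)[of d]
        by (simp add: contract_arc_simps(2) del: contract_arc_simps(3,4))
      show "card (verts (contract_arc G e)) = k + 2"
        using Suc.prems(3) e unfolding contract_arc_simps merge_image[OF e False] by simp
    qed
    then show ?thesis
      unfolding arc_res_eq[OF e Suc.prems(2)[OF e]] contracted_nonloop[OF e False, symmetric]
      by simp
  qed
  then have "contraction_sum (Suc k) G L = fact k * (\<Sum>e\<in>arcs G. contracted e / L e)"
    by (simp add: sum_distrib_left)
  then show ?case
    unfolding sum_contracted using Suc.prems(3) by (simp add: algebra_simps)
qed


section \<open>The resistance function on the metrized graph\<close>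

definition consecutive :: "real set \<Rightarrow> (real \<times> real) set" where
  "consecutive C = {(a, b). a \<in> C \<and> b \<in> C \<and> a < b \<and> {a<..<b} \<inter> C = {}}"

lemma finite_consecutive: "finite C \<Longrightarrow> finite (consecutive C)"
  by (rule finite_subset[of _ "C \<times> C"]) (auto simp: consecutive_def)

lemma consecutive_insert:
  assumes "finite C" "C \<noteq> {}" "\<And>c. c \<in> C \<Longrightarrow> c < x"
  shows "consecutive (insert x C) = insert (Max C, x) (consecutive C)"
proof -
  have M: "Max C \<in> C" using assms by simp
  have "(a, b) \<in> consecutive (insert x C) \<longleftrightarrow> (a, b) \<in> insert (Max C, x) (consecutive C)" for a b
  proof (cases "b = x")
    case True
    have "a = Max C" if "a \<in> C" "{a<..<x} \<inter> C = {}"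
    proof (rule ccontr)
      assume "a \<noteq> Max C"
      then have "a < Max C" using Max_ge[OF assms(1) that(1)] by simp
      then have "Max C \<in> {a<..<x} \<inter> C" using M assms(3) by simp
      then show False using that(2) by blast
    qed
    moreover have "{Max C<..<x} \<inter> C = {}"
      using Max_ge[OF assms(1)] by force
    ultimately show ?thesis
      using True M assms(3) by (auto simp: consecutive_def)
  next
    case False
    then show ?thesis using assms(3) by (force simp: consecutive_def)
  qed
  then show ?thesis by auto
qed

lemma sum_consecutive:
  fixes h :: "real \<Rightarrow> real"
  assumes "finite C" "C \<noteq> {}"
  shows "(\<Sum>(a, b)\<in>consecutive C. h b - h a) = h (Max C) - h (Min C)"
  using assms
proof (induction C rule: finite_linorder_max_induct)
  case (insert x C)
  show ?case
  proof (cases "C = {}")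
    case True
    then have "consecutive (insert x C) = {}" by (auto simp: consecutive_def)
    then show ?thesis using True by simp
  next
    case False
    have "(Max C, x) \<notin> consecutive C" using insert by (auto simp: consecutive_def)
    moreover have "Max (insert x C) = x"
      using insert False by (simp add: max_def) (meson Max_in leD)
    moreover have "Min (insert x C) = Min C"
      using insert False by (simp add: min_def) (meson Min_in leD)
    ultimately show ?thesis
      using insert False by (simp add: consecutive_insert finite_consecutive)
  qed
qed simp

section \<open>Potentials on subdivided arcs\<close>

definition interpolate ::
    "('a, 'b) pre_digraph \<Rightarrow> ('b \<Rightarrow> real) \<Rightarrow> ('a \<Rightarrow> real) \<Rightarrow> ('a, 'b) point \<Rightarrow> real" where
  "interpolate G L f p =
    (case p of Vertex v \<Rightarrow> f v | Interior e t \<Rightarrow> f (tail G e) + t / L e * grad G f e)"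

lemma interpolate_simps [simp]:
  "interpolate G L f (Vertex v) = f v"
  "interpolate G L f (Interior e t) = f (tail G e) + t / L e * grad G f e"
  by (simp_all add: interpolate_def)

text \<open>The default 0 for a point off the interior of \<open>e\<close> makes its tent vanish on
  \<open>e\<close>, so one formula covers all arcs.\<close>

definition arc_position :: "'b \<Rightarrow> ('a, 'b) point \<Rightarrow> real" where
  "arc_position e p = (case p of Vertex v \<Rightarrow> 0 | Interior d t \<Rightarrow> if d = e then t else 0)"

lemma arc_position_simps [simp]:
  "arc_position e (Vertex v) = 0"
  "arc_position e (Interior d t) = (if d = e then t else 0)"
  by (simp_all add: arc_position_def)

text \<open>The potential of the arc through \<open>p\<close> when its ends are grounded and unit current enters at
  \<open>p\<close>; it vanishes if \<open>p\<close> is a vertex.\<close>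

definition tent :: "('b \<Rightarrow> real) \<Rightarrow> ('a, 'b) point \<Rightarrow> ('a, 'b) point \<Rightarrow> real" where
  "tent L p q = (case q of Vertex v \<Rightarrow> 0
    | Interior e t \<Rightarrow> min t (arc_position e p) - t * arc_position e p / L e)"

lemma tent_simps [simp]:
  "tent L p (Vertex v) = 0"
  "tent L p (Interior e t) = min t (arc_position e p) - t * arc_position e p / L e"
  by (simp_all add: tent_def)

abbreviation piece_length :: "'b \<times> real \<times> real \<Rightarrow> real" where
  "piece_length \<equiv> \<lambda>(e, a, b). b - a"

lemma arcs_subdivide: "arcs (subdivide G L S) = Sigma (arcs G) (\<lambda>e. consecutive (cuts L S e))"
  by (auto simp: subdivide_def consecutive_def)

lemma verts_subdivide: "verts (subdivide G L S) = Vertex ` verts G \<union> (S \<inter> points G L)"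
  by (simp add: subdivide_def)

lemma finite_cuts: "finite S \<Longrightarrow> finite (cuts L S e)"
proof -
  assume "finite S"
  then have "finite (Interior e -` S)"
    by (rule finite_vimageI) (simp add: inj_def)
  then show ?thesis
    unfolding cuts_def by (auto elim: rev_finite_subset)
qed

lemma cuts_bounds: "0 < L e \<Longrightarrow> a \<in> cuts L S e \<Longrightarrow> 0 \<le> a \<and> a \<le> L e"
  by (auto simp: cuts_def)

context green
begin

lemma arc_position_bounds:
  assumes "p \<in> points G L" "e \<in> arcs G"
  shows "0 \<le> arc_position e p \<and> arc_position e p < L e"
  using assms length_pos[of e] by (auto simp: points_def)

lemma interpolate_edge_point:
  assumes "e \<in> arcs G"
  shows "interpolate G L f (edge_point G L e t) = f (tail G e) + t / L e * grad G f e"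
  using length_pos[OF assms] by (simp add: edge_point_def grad_def)

lemma tent_edge_point:
  assumes "e \<in> arcs G" "p \<in> points G L" "0 \<le> t" "t \<le> L e"
  shows "tent L p (edge_point G L e t) = min t (arc_position e p) - t * arc_position e p / L e"
  using length_pos[OF assms(1)] arc_position_bounds[OF assms(2,1)] by (auto simp: edge_point_def)

lemma fin_digraph_subdivide:
  assumes "finite S"
  shows "fin_digraph (subdivide G L S)"
proof unfold_locales
  have *: "edge_point G L e t \<in> verts (subdivide G L S)" if "e \<in> arcs G" "t \<in> cuts L S e" for e t
    using that by (auto simp: edge_point_def cuts_def verts_subdivide points_def)
  fix d assume "d \<in> arcs (subdivide G L S)"
  then obtain e a b where d: "d = (e, a, b)" "e \<in> arcs G" "(a, b) \<in> consecutive (cuts L S e)"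
    by (auto simp: arcs_subdivide)
  then show "tail (subdivide G L S) d \<in> verts (subdivide G L S)"
    and "head (subdivide G L S) d \<in> verts (subdivide G L S)"
    using *[of e a] *[of e b] by (auto simp: subdivide_def consecutive_def)
next
  show "finite (verts (subdivide G L S))" "finite (arcs (subdivide G L S))"
    using assms by (auto simp: verts_subdivide arcs_subdivide finite_cuts finite_consecutive)
qed

lemma dirichlet_subdivide:
  assumes "finite S"
  shows "dirichlet (subdivide G L S) piece_length F \<Phi> =
    (\<Sum>e\<in>arcs G. \<Sum>(a, b)\<in>consecutive (cuts L S e).
      (F (edge_point G L e b) - F (edge_point G L e a))
      * (\<Phi> (edge_point G L e b) - \<Phi> (edge_point G L e a)) / (b - a))"
proof -
  have "dirichlet (subdivide G L S) piece_length F \<Phi> =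
    (\<Sum>(e, ab)\<in>Sigma (arcs G) (\<lambda>e. consecutive (cuts L S e)).
     (case ab of (a, b) \<Rightarrow> (F (edge_point G L e b) - F (edge_point G L e a))
      * (\<Phi> (edge_point G L e b) - \<Phi> (edge_point G L e a)) / (b - a)))"
    unfolding dirichlet_def arcs_subdivide
    by (intro sum.cong refl) (auto simp: grad_def subdivide_def)
  then show ?thesis
    using assms by (subst sum.Sigma) (auto simp: finite_cuts finite_consecutive)
qed

lemma sum_cuts:
  fixes h :: "real \<Rightarrow> real"
  assumes "finite S" "e \<in> arcs G"
  shows "(\<Sum>(a, b)\<in>consecutive (cuts L S e). h b - h a) = h (L e) - h 0"
proof -
  have L: "0 < L e" using length_pos assms by simp
  have "0 \<in> cuts L S e" "L e \<in> cuts L S e" by (auto simp: cuts_def)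
  then have "Max (cuts L S e) = L e" "Min (cuts L S e) = 0"
    using cuts_bounds[of L e _ S, OF L] finite_cuts[OF assms(1)]
    by (auto intro!: Max_eqI Min_eqI)
  then show ?thesis
    using sum_consecutive[of "cuts L S e" h] finite_cuts[OF assms(1)] \<open>0 \<in> cuts L S e\<close> by auto
qed

text \<open>The slope is constant along an arc, so the pieces telescope and no current enters or
  leaves at the cut points.\<close>

lemma dirichlet_interpolate:
  assumes "finite S"
  shows "dirichlet (subdivide G L S) piece_length (interpolate G L f) \<Phi> = dirichlet G L f (\<lambda>v. \<Phi> (Vertex v))"
  unfolding dirichlet_subdivide[OF assms]
  unfolding dirichlet_def
proof (rule sum.cong[OF refl])
  fix e assume e: "e \<in> arcs G"
  let ?p = "edge_point G L e"
  have L: "0 < L e" using length_pos[OF e] .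
  have "(\<Sum>(a, b)\<in>consecutive (cuts L S e).
      (interpolate G L f (?p b) - interpolate G L f (?p a)) * (\<Phi> (?p b) - \<Phi> (?p a)) / (b - a))
     = (\<Sum>(a, b)\<in>consecutive (cuts L S e). grad G f e / L e * \<Phi> (?p b) - grad G f e / L e * \<Phi> (?p a))"
  proof (intro sum.cong refl, clarify)
    fix a b assume "(a, b) \<in> consecutive (cuts L S e)"
    then have ab: "a < b" by (auto simp: consecutive_def)
    have "interpolate G L f (?p b) - interpolate G L f (?p a) = (b - a) * (grad G f e / L e)"
      unfolding interpolate_edge_point[OF e] by (simp add: diff_divide_distrib algebra_simps)
    moreover have "(b - a) * k * w / (b - a) = k * w" for k w
      using ab by simp
    ultimately show "(interpolate G L f (?p b) - interpolate G L f (?p a)) * (\<Phi> (?p b) - \<Phi> (?p a)) / (b - a)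
       = grad G f e / L e * \<Phi> (?p b) - grad G f e / L e * \<Phi> (?p a)"
      by (simp only: right_diff_distrib[symmetric])
  qed
  also have "\<dots> = grad G f e / L e * \<Phi> (?p (L e)) - grad G f e / L e * \<Phi> (?p 0)"
    by (rule sum_cuts[OF assms e])
  also have "\<dots> = grad G f e * grad G (\<lambda>v. \<Phi> (Vertex v)) e / L e"
    using L by (simp add: edge_point_def grad_def[of G "\<lambda>v. \<Phi> (Vertex v)"] right_diff_distrib diff_divide_distrib)
  finally show "(\<Sum>(a, b)\<in>consecutive (cuts L S e).
      (interpolate G L f (?p b) - interpolate G L f (?p a)) * (\<Phi> (?p b) - \<Phi> (?p a)) / (b - a))
     = grad G f e * grad G (\<lambda>v. \<Phi> (Vertex v)) e / L e" .
qed

text \<open>The slope of the tent drops by 1 at \<open>p\<close>: unit current enters there and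
  leaves at the two ends of the arc in the proportions of linear interpolation.\<close>

lemma dirichlet_tent:
  assumes "finite S" "p \<in> S" "p \<in> points G L"
  shows "dirichlet (subdivide G L S) piece_length (tent L p) \<Phi>
    = \<Phi> p - interpolate G L (\<lambda>v. \<Phi> (Vertex v)) p"
proof -
  have arc: "(\<Sum>(a, b)\<in>consecutive (cuts L S e).
      (tent L p (edge_point G L e b) - tent L p (edge_point G L e a))
        * (\<Phi> (edge_point G L e b) - \<Phi> (edge_point G L e a)) / (b - a))
     = \<Phi> (edge_point G L e s) - (\<Phi> (Vertex (tail G e)) + s / L e * grad G (\<lambda>v. \<Phi> (Vertex v)) e)"
    if e: "e \<in> arcs G" and s: "s = arc_position e p" for e s
  proof -
    let ?p = "edge_point G L e"
    have L: "0 < L e" using length_pos[OF e] .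
    have sb: "0 \<le> s" "s < L e" using arc_position_bounds[OF assms(3) e] s by auto
    have s_cut: "s \<in> cuts L S e"
      using assms(2,3) e s by (cases p) (auto simp: cuts_def points_def)
    \<comment> \<open>Slope times \<Phi>, shifted to vanish at the break \<open>s\<close>, so that
      either slope fits there. As \<open>s\<close> is a cut, no piece straddles it and the sum
      telescopes.\<close>
    define h where "h u = (if u \<le> s then 1 - s / L e else - (s / L e)) * (\<Phi> (?p u) - \<Phi> (?p s))" for u
    have "(\<Sum>(a, b)\<in>consecutive (cuts L S e).
        (tent L p (?p b) - tent L p (?p a)) * (\<Phi> (?p b) - \<Phi> (?p a)) / (b - a))
       = (\<Sum>(a, b)\<in>consecutive (cuts L S e). h b - h a)"
    proof (intro sum.cong refl, clarify)
      fix a b assume "(a, b) \<in> consecutive (cuts L S e)"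
      then have ab: "a < b" "a \<in> cuts L S e" "b \<in> cuts L S e" "b \<le> s \<or> s \<le> a"
        using s_cut by (auto simp: consecutive_def disjoint_iff) (meson not_le)
      have t: "tent L p (?p u) = min u s - u * s / L e" if "u \<in> cuts L S e" for u
        using cuts_bounds[OF L that] by (simp add: tent_edge_point e assms(3) s)
      define k where "k = (if b \<le> s then 1 - s / L e else - (s / L e))"
      have "tent L p (?p b) - tent L p (?p a) = (b - a) * k"
        unfolding t[OF ab(2)] t[OF ab(3)] k_def using ab(1,4)
        by (auto simp: min_def algebra_simps diff_divide_distrib)
      moreover have "h b - h a = k * (\<Phi> (?p b) - \<Phi> (?p a))"
        using ab(1,4) unfolding h_def k_def by (cases "a = s") (auto simp: algebra_simps)
      ultimately show "(tent L p (?p b) - tent L p (?p a)) * (\<Phi> (?p b) - \<Phi> (?p a)) / (b - a) = h b - h a"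
        using ab(1) by simp
    qed
    also have "\<dots> = h (L e) - h 0"
      by (rule sum_cuts[OF assms(1) e])
    also have "\<dots> = \<Phi> (?p s) - (\<Phi> (Vertex (tail G e)) + s / L e * grad G (\<lambda>v. \<Phi> (Vertex v)) e)"
    proof -
      have "?p 0 = Vertex (tail G e)" "?p (L e) = Vertex (head G e)"
        using L by (auto simp: edge_point_def)
      then show ?thesis using sb by (simp add: h_def grad_def algebra_simps)
    qed
    finally show ?thesis .
  qed
  show ?thesis
  proof (cases p)
    case (Vertex v)
    then show ?thesis
      unfolding dirichlet_subdivide[OF assms(1)]
      by (subst sum.cong[OF refl arc[OF _ refl]]) (auto simp: edge_point_def)
  next
    case (Interior d t)
    then have d: "d \<in> arcs G" "0 < t" "t < L d" using assms(3) by (auto simp: points_def)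
    have "dirichlet (subdivide G L S) piece_length (tent L p) \<Phi>
       = (\<Sum>e\<in>arcs G. if e = d then \<Phi> p - interpolate G L (\<lambda>v. \<Phi> (Vertex v)) p else 0)"
      unfolding dirichlet_subdivide[OF assms(1)]
      using d by (intro sum.cong refl, subst arc[OF _ refl]) (auto simp: edge_point_def Interior)
    then show ?thesis using d by simp
  qed
qed

text \<open>The Green function of the metrized graph grounded at \<open>Vertex z\<close>. The first
  summand feeds the current into the ends of the arc through \<open>p\<close> in the interpolating
  proportions; the tent moves the source from these ends to \<open>p\<close>.\<close>

definition potential :: "('a, 'b) point \<Rightarrow> ('a, 'b) point \<Rightarrow> real" where
  "potential p q = interpolate G L (\<lambda>v. interpolate G L (\<lambda>u. g u v) p) q + tent L p q"

lemma dirichlet_interpolate_g: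
  assumes "p \<in> points G L"
  shows "dirichlet G L (\<lambda>v. interpolate G L (\<lambda>u. g u v) p) \<phi> = interpolate G L \<phi> p - \<phi> z"
proof (cases p)
  case (Vertex v)
  then show ?thesis using assms by (auto simp: points_def dirichlet_g)
next
  case (Interior e t)
  then have "e \<in> arcs G" using assms by (auto simp: points_def)
  then show ?thesis
    by (simp add: Interior grad_def dirichlet_linear dirichlet_g del: times_divide_eq_left)
qed

lemma dirichlet_potential:
  assumes "finite S" "p \<in> S" "p \<in> points G L"
  shows "dirichlet (subdivide G L S) piece_length (potential p) \<Phi> = \<Phi> p - \<Phi> (Vertex z)"
  unfolding potential_def[abs_def] dirichlet_add_left dirichlet_tent[OF assms]
    dirichlet_interpolate[OF assms(1)] dirichlet_interpolate_g[OF assms(3)] by simp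

lemma potential_base: "p \<in> points G L \<Longrightarrow> potential p (Vertex z) = 0"
  by (cases p) (auto simp: potential_def points_def g_base grad_def)

lemma potential_commute:
  assumes "p \<in> points G L" "q \<in> points G L"
  shows "potential p q = potential q p"
  using dirichlet_potential[of "{p, q}" p "potential q"] dirichlet_potential[of "{p, q}" q "potential p"] assms
  by (simp add: potential_base dirichlet_commute)

lemma resistance_eq:
  assumes "x \<in> points G L" "y \<in> points G L"
  shows "resistance G L x y = potential x x + potential y y - 2 * potential y x"
proof -
  let ?H = "subdivide G L {x, y}"
  interpret H: fin_digraph ?H by (rule fin_digraph_subdivide) simp
  have "resistance G L x y = (potential x x - potential y x) - (potential x y - potential y y)"
    unfolding resistance_def
  proof (rule H.eff_res_eq)
    show "dirichlet ?H piece_length (\<lambda>p. potential x p - potential y p) \<Phi> = \<Phi> x - \<Phi> y" for \<Phi>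
      using assms by (simp add: dirichlet_diff_left dirichlet_potential)
  qed (use assms in \<open>auto simp: verts_subdivide\<close>)
  then show ?thesis
    using potential_commute[OF assms] by simp
qed

section \<open>The tau constant\<close>

abbreviation (input) "vertex_part y v \<equiv> interpolate G L (\<lambda>u. g u v) y"

text \<open>In the quadratic term the tent contributes t(L - t)/L, and interpolating
  \<open>g\<close> in both arguments takes off t(L - t)/L^2 times \<open>res_arc e\<close>.\<close>

lemma resistance_on_arc:
  assumes e: "e \<in> arcs G" and t: "0 < t" "t < L e" and y: "y \<in> points G L"
  shows "resistance G L (edge_point G L e t) y =
    g (tail G e) (tail G e) + t / L e * grad G (\<lambda>x. g x x) e + t * (L e - t) * (L e - res_arc e) / (L e)\<^sup>2
    + potential y y - 2 * (vertex_part y (tail G e) + t / L e * grad G (vertex_part y) e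
      + min t (arc_position e y) - t * arc_position e y / L e)"
proof -
  have p: "edge_point G L e t = Interior e t" "Interior e t \<in> points G L"
    using e t by (auto simp: edge_point_def points_def)
  define \<tau> where "\<tau> = t / L e"
  have tau: "t = \<tau> * L e" using t by (simp add: \<tau>_def)
  have L: "L e \<noteq> 0" using t by simp
  have "potential (Interior e t) (Interior e t) =
     g (tail G e) (tail G e) + t / L e * grad G (\<lambda>x. g x x) e + t * (L e - t) * (L e - res_arc e) / (L e)\<^sup>2"
    using g_commute[of "tail G e" "head G e"] e L unfolding tau
    by (simp add: potential_def grad_def power2_eq_square) (simp add: field_simps)
  moreover have "potential y (Interior e t) = vertex_part y (tail G e) + t / L e * grad G (vertex_part y) e
      + min t (arc_position e y) - t * arc_position e y / L e"
    by (simp add: potential_def)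
  ultimately show ?thesis
    unfolding p(1) resistance_eq[OF p(2) y] by simp
qed

lemma deriv_resistance_on_arc:
  assumes e: "e \<in> arcs G" and t: "0 < t" "t < L e" and y: "y \<in> points G L" and s: "s = arc_position e y" "t \<noteq> s"
  shows "deriv (\<lambda>u. resistance G L (edge_point G L e u) y) t =
    (grad G (\<lambda>x. g x x) e - 2 * grad G (vertex_part y) e) / L e
    + (L e - 2 * t) * (L e - res_arc e) / (L e)\<^sup>2 + 2 * s / L e - (if t < s then 2 else 0)"
proof (rule DERIV_imp_deriv)
  \<comment> \<open>The open part of the arc on the side of \<open>s\<close> containing
    \<open>t\<close>; there \<open>min u s\<close> is the affine function
    \<open>j * u + w\<close>.\<close>
  define S where "S = (if t < s then {0<..<s} else {s<..<L e})"
  have S: "open S" "t \<in> S" and S_sub: "S \<subseteq> {0<..<L e}"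
    using t s(2) arc_position_bounds[OF y e] by (auto simp: S_def s(1))
  define j where "j = (if t < s then 1 else (0::real))"
  define w where "w = (if t < s then 0 else s)"
  have min_eq: "min u s = j * u + w" if "u \<in> S" for u
    using that t s(2) by (auto simp: S_def j_def w_def split: if_splits)
  have poly: "((\<lambda>u. a + u / l * k + u * (l - u) * c / l\<^sup>2 + p - 2 * (v + u / l * k' + (j * u + w) - u * s / l))
      has_real_derivative (k - 2 * k') / l + (l - 2 * t) * c / l\<^sup>2 + 2 * s / l - 2 * j) (at t)"
    if "l \<noteq> 0" for a k l c p v k'
    using that by (auto intro!: derivative_eq_intros simp: field_simps power2_eq_square)
  have "((\<lambda>u. resistance G L (edge_point G L e u) y) has_real_derivative
      (grad G (\<lambda>x. g x x) e - 2 * grad G (vertex_part y) e) / L e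
      + (L e - 2 * t) * (L e - res_arc e) / (L e)\<^sup>2 + 2 * s / L e - 2 * j) (at t)"
  proof (rule has_field_derivative_transform_within_open[OF poly S])
    fix u assume u: "u \<in> S"
    then have "0 < u" "u < L e" using S_sub by auto
    from resistance_on_arc[OF e this y]
    show "g (tail G e) (tail G e) + u / L e * grad G (\<lambda>x. g x x) e + u * (L e - u) * (L e - res_arc e) / (L e)\<^sup>2
        + potential y y - 2 * (vertex_part y (tail G e) + u / L e * grad G (vertex_part y) e
        + (j * u + w) - u * s / L e) = resistance G L (edge_point G L e u) y"
      unfolding s(1)[symmetric] min_eq[OF u] by simp
  qed (use t in simp)
  then show "((\<lambda>u. resistance G L (edge_point G L e u) y) has_real_derivative
      (grad G (\<lambda>x. g x x) e - 2 * grad G (vertex_part y) e) / L e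
      + (L e - 2 * t) * (L e - res_arc e) / (L e)\<^sup>2 + 2 * s / L e - (if t < s then 2 else 0)) (at t)"
    by (simp add: j_def if_distrib[of "\<lambda>x. 2 * x"] cong: if_cong)
qed

end

section \<open>Integrals of squared affine functions with a jump\<close>

lemma has_integral_square_affine:
  fixes a b c d :: real
  assumes "a \<le> b"
  shows "((\<lambda>t. (c + d * t)\<^sup>2) has_integral
    (c\<^sup>2 * b + c * d * b\<^sup>2 + d\<^sup>2 * b ^ 3 / 3) - (c\<^sup>2 * a + c * d * a\<^sup>2 + d\<^sup>2 * a ^ 3 / 3)) {a..b}"
proof (rule fundamental_theorem_of_calculus[OF assms])
  show "((\<lambda>t. c\<^sup>2 * t + c * d * t\<^sup>2 + d\<^sup>2 * t ^ 3 / 3) has_vector_derivative (c + d * x)\<^sup>2) (at x within {a..b})" for x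
    unfolding has_real_derivative_iff_has_vector_derivative[symmetric]
    by (rule derivative_eq_intros refl | simp)+ (simp add: power2_eq_square algebra_simps)
qed

lemma has_integral_square_affine_jump:
  fixes s l c d j :: real
  assumes "0 \<le> s" "s \<le> l"
  shows "((\<lambda>t. (c + d * t - (if t < s then j else 0))\<^sup>2) has_integral
    c\<^sup>2 * l + c * d * l\<^sup>2 + d\<^sup>2 * l ^ 3 / 3 + (j\<^sup>2 - 2 * c * j) * s - j * d * s\<^sup>2) {0..l}"
proof -
  \<comment> \<open>At \<open>t = s\<close> the integrand already takes its right-hand value, so
    that point is excepted on the left interval.\<close>
  have "((\<lambda>t. (c + d * t - (if t < s then j else 0))\<^sup>2) has_integral
      ((c - j)\<^sup>2 * s + (c - j) * d * s\<^sup>2 + d\<^sup>2 * s ^ 3 / 3) - ((c - j)\<^sup>2 * 0 + (c - j) * d * 0\<^sup>2 + d\<^sup>2 * 0 ^ 3 / 3)) {0..s}"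
    by (rule has_integral_spike_finite[OF _ _ has_integral_square_affine[OF assms(1)], of "{s}"])
       (auto simp: algebra_simps)
  moreover have "((\<lambda>t. (c + d * t - (if t < s then j else 0))\<^sup>2) has_integral
      (c\<^sup>2 * l + c * d * l\<^sup>2 + d\<^sup>2 * l ^ 3 / 3) - (c\<^sup>2 * s + c * d * s\<^sup>2 + d\<^sup>2 * s ^ 3 / 3)) {s..l}"
    by (rule has_integral_eq[OF _ has_integral_square_affine[OF assms(2)]]) auto
  ultimately have "((\<lambda>t. (c + d * t - (if t < s then j else 0))\<^sup>2) has_integral
      ((c - j)\<^sup>2 * s + (c - j) * d * s\<^sup>2 + d\<^sup>2 * s ^ 3 / 3) - ((c - j)\<^sup>2 * 0 + (c - j) * d * 0\<^sup>2 + d\<^sup>2 * 0 ^ 3 / 3)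
      + ((c\<^sup>2 * l + c * d * l\<^sup>2 + d\<^sup>2 * l ^ 3 / 3) - (c\<^sup>2 * s + c * d * s\<^sup>2 + d\<^sup>2 * s ^ 3 / 3))) {0..l}"
    using assms by (intro has_integral_combine[of 0 s l]) auto
  then show ?thesis
    by (rule back_subst[where P = "\<lambda>v. (_ has_integral v) _"]) (simp add: power2_eq_square algebra_simps)
qed

context green
begin

lemma integral_deriv_resistance_squared:
  assumes e: "e \<in> arcs G" and y: "y \<in> points G L" and s: "s = arc_position e y"
  shows "integral {0..L e} (\<lambda>t. (deriv (\<lambda>u. resistance G L (edge_point G L e u) y) t)\<^sup>2)
    = (grad G (\<lambda>x. g x x - 2 * vertex_part y x) e)\<^sup>2 / L e + (L e - res_arc e)\<^sup>2 / (3 * L e)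
      + 4 * (s / L e) * (1 - s / L e) * res_arc e"
proof -
  define k where "k = grad G (\<lambda>x. g x x - 2 * vertex_part y x) e"
  define r where "r = res_arc e"
  define l where "l = L e"
  define c where "c = k / l + (l - r) / l + 2 * s / l"
  define d where "d = - (2 * (l - r) / l\<^sup>2)"
  have l: "0 < l" using length_pos[OF e] by (simp add: l_def)
  have sb: "0 \<le> s" "s \<le> l" using arc_position_bounds[OF y e] s by (auto simp: l_def)
  have k: "k = grad G (\<lambda>x. g x x) e - 2 * grad G (vertex_part y) e"
    unfolding k_def by (simp only: grad_diff grad_cmult)
  have "((\<lambda>t. (deriv (\<lambda>u. resistance G L (edge_point G L e u) y) t)\<^sup>2) has_integral
      c\<^sup>2 * l + c * d * l\<^sup>2 + d\<^sup>2 * l ^ 3 / 3 + (2\<^sup>2 - 2 * c * 2) * s - 2 * d * s\<^sup>2) {0..l}"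
  \<comment> \<open>The derivative formula is available away from the ends of the arc and the kink
    at \<open>s\<close>, a finite set.\<close>
  proof (rule has_integral_spike_finite[OF _ _ has_integral_square_affine_jump[OF sb], of "{0, s, l}"])
    fix t assume t: "t \<in> {0..l} - {0, s, l}"
    then have "deriv (\<lambda>u. resistance G L (edge_point G L e u) y) t
      = k / l + (l - 2 * t) * (l - r) / l\<^sup>2 + 2 * s / l - (if t < s then 2 else 0)"
      unfolding k l_def r_def by (intro deriv_resistance_on_arc[OF e _ _ y s]) auto
    also have "(l - 2 * t) * (l - r) / l\<^sup>2 = (l - r) / l + d * t"
      unfolding d_def using l by (simp add: field_simps power2_eq_square)
    also have "k / l + ((l - r) / l + d * t) + 2 * s / l - (if t < s then 2 else 0)
      = c + d * t - (if t < s then 2 else 0)"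
      by (simp add: c_def)
    finally show "(deriv (\<lambda>u. resistance G L (edge_point G L e u) y) t)\<^sup>2
      = (c + d * t - (if t < s then 2 else 0))\<^sup>2"
      by (rule arg_cong)
  qed simp
  moreover have "c\<^sup>2 * l + c * d * l\<^sup>2 + d\<^sup>2 * l ^ 3 / 3 + (2\<^sup>2 - 2 * c * 2) * s - 2 * d * s\<^sup>2
      = k\<^sup>2 / l + (l - r)\<^sup>2 / (3 * l) + 4 * (s / l) * (1 - s / l) * r"
  proof -
    \<comment> \<open>Rescaling by \<open>l\<close> reduces the claim to a polynomial
      identity.\<close>
    define A where "A = k / l"
    define B where "B = (l - r) / l"
    define S where "S = s / l"
    have c: "c = A + B + 2 * S" by (simp add: c_def A_def B_def S_def)
    have dl: "d * l = - 2 * B" using l by (simp add: d_def B_def power2_eq_square minus_divide_left)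
    have s: "s = S * l" and kA: "k\<^sup>2 / l = A\<^sup>2 * l" and rB: "(l - r)\<^sup>2 / (3 * l) = B\<^sup>2 * l / 3"
      and r: "r = (1 - B) * l"
      using l by (simp_all add: S_def A_def B_def power2_eq_square) (simp add: field_simps)
    have "c\<^sup>2 * l + c * d * l\<^sup>2 + d\<^sup>2 * l ^ 3 / 3 + (2\<^sup>2 - 2 * c * 2) * s - 2 * d * s\<^sup>2
      = (c\<^sup>2 + c * (d * l) + (d * l)\<^sup>2 / 3 + (4 - 4 * c) * S - 2 * (d * l) * S\<^sup>2) * l"
      unfolding s by (simp add: power2_eq_square power3_eq_cube algebra_simps)
    also have "\<dots> = A\<^sup>2 * l + B\<^sup>2 * l / 3 + 4 * S * (1 - S) * ((1 - B) * l)"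
      unfolding dl c by (simp add: power2_eq_square algebra_simps)
    finally show ?thesis
      unfolding kA rB r[symmetric] S_def[symmetric] .
  qed
  ultimately have "integral {0..l} (\<lambda>t. (deriv (\<lambda>u. resistance G L (edge_point G L e u) y) t)\<^sup>2)
      = k\<^sup>2 / l + (l - r)\<^sup>2 / (3 * l) + 4 * (s / l) * (1 - s / l) * r"
    by (simp only: integral_unique)
  then show ?thesis
    unfolding k_def r_def l_def .
qed

text \<open>Independence of the base point. Expanding the square and using Kirchhoff's law for
  \<open>vertex_part y\<close> leaves 4 times the difference at \<open>y\<close> between
  interpolating the diagonal of \<open>g\<close> and interpolating \<open>g\<close> twice; this is
  exactly the sum of the jump terms.\<close>

lemma dirichlet_resistance:
  assumes y: "y \<in> points G L"
  shows "dirichlet G L (\<lambda>x. g x x - 2 * vertex_part y x) (\<lambda>x. g x x - 2 * vertex_part y x)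
      + (\<Sum>e\<in>arcs G. 4 * (arc_position e y / L e) * (1 - arc_position e y / L e) * res_arc e)
    = dirichlet G L (\<lambda>x. g x x) (\<lambda>x. g x x)"
proof -
  have E: "dirichlet G L (vertex_part y) \<phi> = interpolate G L \<phi> y - \<phi> z" for \<phi>
    by (rule dirichlet_interpolate_g[OF y])
  have base: "vertex_part y z = 0"
    using y by (cases y) (auto simp: points_def g_base grad_def)
  have "dirichlet G L (\<lambda>x. g x x - 2 * vertex_part y x) (\<lambda>x. g x x - 2 * vertex_part y x)
    = dirichlet G L (\<lambda>x. g x x) (\<lambda>x. g x x)
      - 4 * dirichlet G L (vertex_part y) (\<lambda>x. g x x) + 4 * dirichlet G L (vertex_part y) (vertex_part y)"
    by (simp add: dirichlet_linear dirichlet_commute[of G L "\<lambda>x. g x x" "vertex_part y"])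
  also have "\<dots> = dirichlet G L (\<lambda>x. g x x) (\<lambda>x. g x x)
      - 4 * (interpolate G L (\<lambda>x. g x x) y - interpolate G L (vertex_part y) y)"
    by (simp add: E base g_base base_in_verts)
  finally have *: "dirichlet G L (\<lambda>x. g x x - 2 * vertex_part y x) (\<lambda>x. g x x - 2 * vertex_part y x)
    = dirichlet G L (\<lambda>x. g x x) (\<lambda>x. g x x)
      - 4 * (interpolate G L (\<lambda>x. g x x) y - interpolate G L (vertex_part y) y)" .
  have "(\<Sum>e\<in>arcs G. 4 * (arc_position e y / L e) * (1 - arc_position e y / L e) * res_arc e)
     = 4 * (interpolate G L (\<lambda>x. g x x) y - interpolate G L (vertex_part y) y)"
  proof (cases y)
    case (Vertex v)
    then show ?thesis by simp
  next
    case (Interior d t)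
    then have d: "d \<in> arcs G" using y by (auto simp: points_def)
    have "(\<Sum>e\<in>arcs G. 4 * (arc_position e y / L e) * (1 - arc_position e y / L e) * res_arc e)
       = (\<Sum>e\<in>arcs G. if e = d then 4 * (t / L d) * (1 - t / L d) * res_arc d else 0)"
      by (intro sum.cong) (auto simp: Interior)
    also have "\<dots> = 4 * (t / L d) * (1 - t / L d) * res_arc d"
      using d by simp
    also have "\<dots> = 4 * (interpolate G L (\<lambda>x. g x x) y - interpolate G L (vertex_part y) y)"
      unfolding Interior interpolate_simps grad_def
      using g_commute[of "tail G d" "head G d"] d by (simp add: algebra_simps del: times_divide_eq_left times_divide_eq_right)
    finally show ?thesis .
  qed
  then show ?thesis using * by simp
qed

lemma tau_at_eq:
  assumes "y \<in> points G L"
  shows "tau_at G L y = 1 / 4 * (\<Sum>e\<in>arcs G. (grad G (\<lambda>x. g x x) e)\<^sup>2 / L e + (L e - res_arc e)\<^sup>2 / (3 * L e))"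
proof -
  have "tau_at G L y = 1 / 4 * (dirichlet G L (\<lambda>x. g x x - 2 * vertex_part y x) (\<lambda>x. g x x - 2 * vertex_part y x)
      + (\<Sum>e\<in>arcs G. 4 * (arc_position e y / L e) * (1 - arc_position e y / L e) * res_arc e)
      + (\<Sum>e\<in>arcs G. (L e - res_arc e)\<^sup>2 / (3 * L e)))"
    unfolding tau_at_def dirichlet_def sum.distrib[symmetric]
    using assms by (intro arg_cong[of _ _ "\<lambda>u. 1 / 4 * u"] sum.cong refl)
      (simp add: integral_deriv_resistance_squared[OF _ _ refl] power2_eq_square[of "grad G _ _"])
  then show ?thesis
    unfolding dirichlet_resistance[OF assms]
    by (simp add: dirichlet_def sum.distrib power2_eq_square)
qed

lemma tau_eq: "tau G L = total_length G L / 12 - 1 / 6 * contraction_value G L g"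
proof -
  \<comment> \<open>A point exists, so the common value in \<open>tau\<close> is unique.\<close>
  have "Vertex z \<in> points G L" using base_in_verts by (simp add: points_def)
  then have "tau G L = 1 / 4 * (\<Sum>e\<in>arcs G. (grad G (\<lambda>x. g x x) e)\<^sup>2 / L e + (L e - res_arc e)\<^sup>2 / (3 * L e))"
    unfolding tau_def using tau_at_eq by (intro the_equality) auto
  also have "\<dots> = (\<Sum>e\<in>arcs G. L e / 12 - 1 / 6 * res_arc e
      + 1 / 12 * (((res_arc e)\<^sup>2 + 3 * (grad G (\<lambda>x. g x x) e)\<^sup>2) / L e))"
    unfolding sum_distrib_left
  proof (rule sum.cong[OF refl])
    fix e assume "e \<in> arcs G"
    then have "0 < L e" by (rule length_pos)
    then have "1 / 4 * (k\<^sup>2 / L e + (L e - r)\<^sup>2 / (3 * L e)) = L e / 12 - 1 / 6 * r + 1 / 12 * ((r\<^sup>2 + 3 * k\<^sup>2) / L e)"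
      for k r by (simp add: field_simps power2_eq_square)
    then show "1 / 4 * ((grad G (\<lambda>x. g x x) e)\<^sup>2 / L e + (L e - res_arc e)\<^sup>2 / (3 * L e))
      = L e / 12 - 1 / 6 * res_arc e + 1 / 12 * (((res_arc e)\<^sup>2 + 3 * (grad G (\<lambda>x. g x x) e)\<^sup>2) / L e)" .
  qed
  also have "\<dots> = total_length G L / 12 - 1 / 6 * (\<Sum>e\<in>arcs G. res_arc e)
      + 1 / 12 * (4 * ((\<Sum>x\<in>verts G. g x x) - (\<Sum>e\<in>arcs G. minor e / L e)))"
    unfolding sum_res_squared[symmetric] total_length_def
    by (simp only: sum.distrib sum_subtractf sum_distrib_left[symmetric] sum_divide_distrib[symmetric])
  also have "\<dots> = total_length G L / 12 - 1 / 6 * contraction_value G L g"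
  proof -
    have "a - 1 / 6 * r + 1 / 12 * (4 * (b - c)) = a - 1 / 6 * (r - 2 * (b - c))" for a b c r :: real
      by (simp add: field_simps)
    then show ?thesis unfolding contraction_value_def .
  qed
  finally show ?thesis .
qed

end

theorem theorem5p10:
  fixes G :: "('a, 'b) pre_digraph" and L :: "'b \<Rightarrow> real"
  assumes "metrized_graph G L"
    and "bridgeless G"
    and "card (verts G) \<ge> 3"
  shows "tau G L = total_length G L / 12
           - 1 / (6 * fact (card (verts G) - 2)) * contraction_sum (card (verts G) - 2) G L"
proof -
  interpret metrized_graph G L by fact
  obtain z where "z \<in> verts G"
    using assms(3) by fastforce
  then obtain g where "green G L z g"
    using green_exists by blast
  then interpret green G L z g .
  \<comment> \<open>The natural subtraction is exact because there are at least three
    vertices.\<close>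
  have "contraction_sum (card (verts G) - 2) G L = fact (card (verts G) - 2) * contraction_value G L g"
    using \<open>green G L z g\<close> assms(2,3) res_arc_less
    by (intro contraction_sum_eq) (auto simp: bridgeless_def)
  then show ?thesis
    by (simp add: tau_eq)
qed

end
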